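(* There exists a universal constant $\kappa>0$ such that for every $n\ge 1$, every symmetric log-concave random vector $X$ in $\mathbb{R}^n$ and all vectors $u,v\in\mathbb{R}^n$ we have \[ e^{\kappa\, \mathcal{S}(\langle u+v, X\rangle)} \leq e^{\kappa\, \mathcal{S}(\langle u, X\rangle)}+e^{\kappa\, \mathcal{S}(\langle v, X\rangle)}. \] Equivalently, for every symmetric log-concave random vector $(X,Y)$ in $\mathbb{R}^2$ we have \[ e^{\kappa\, \mathcal{S}(X+Y)} \leq e^{\kappa\, \mathcal{S}(X)}+e^{\kappa\, \mathcal{S}(Y)}. \] In fact, one can take $\kappa = 1/5$.
   Context: For a real random variable $Z$ with density $f$, its entropy is $\mathcal{S}(Z)=\mathcal{S}(f)=-\int_{\mathbb{R}} f\ln f$ (with $0\ln 0=0$), provided the integral exists in the Lebesgue sense; the entropy of a log-concave random variable is well defined and finite. A random vector in $\mathbb{R}^n$ is log-concave if it has a density of the form $e^{-\psi}$ with $\psi:\mathbb{R}^n\to(-\infty,+\infty]$ convex. It is symmetric if $X$ and $-X$ have the same distribution (equivalently, the density can be taken even). $\langle\cdot,\cdot\rangle$ is the standard scalar product. Convention: for the zero vector $w=0$, $e^{\kappa\,\mathcal{S}(\langle w,X\rangle)}$ is understood to be $0$. *)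

theory Defs
  imports "HOL-Probability.Probability"
begin

text \<open>
  Differential entropy in nats. The library constant is the negative of the Kullback-Leibler
  divergence of the law of \<open>Z\<close> with respect to Lebesgue measure; the lemma below gives the usual
  formula (with \<open>0 * ln 0 = 0\<close>, as \<open>ln 0 = 0\<close> here). A non-integrable \<open>f ln f\<close> would give
  entropy \<open>0\<close>, but this does not occur for log-concave \<open>Z\<close>.
\<close>
abbreviation Ent :: "'a measure \<Rightarrow> ('a \<Rightarrow> real) \<Rightarrow> real" where
  "Ent M Z \<equiv> prob_space.entropy M (exp 1) lborel Z"

lemma Ent_distributed:
  assumes "prob_space M" and f: "distributed M lborel Z (\<lambda>x. ennreal (f x))" and nn: "\<And>x. 0 \<le> f x"
  shows "Ent M Z = - (\<integral>x. f x * ln (f x) \<partial>lborel)"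
proof -
  interpret information_space M "exp 1"
    using assms(1) by (simp add: information_space_def information_space_axioms_def)
  show ?thesis
    using entropy_distr[OF f] nn by (simp add: log_def)
qed

text \<open>
  Points of \<open>n\<close>-dimensional space are functions \<open>x\<close> of type \<open>nat \<Rightarrow> real\<close> with coordinates
  \<open>x 0, \<dots>, x (n - 1)\<close>, extensional outside \<open>{..<n}\<close>; so the dimension can be quantified over
  inside a formula.
\<close>
abbreviation lborel_n :: "nat \<Rightarrow> (nat \<Rightarrow> real) measure" where
  "lborel_n n \<equiv> (\<Pi>\<^sub>M i\<in>{..<n}. lborel)"

definition scalar_prod :: "nat \<Rightarrow> (nat \<Rightarrow> real) \<Rightarrow> (nat \<Rightarrow> real) \<Rightarrow> real" where
  "scalar_prod n w x = (\<Sum>i<n. w i * x i)"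

text \<open>
  Convexity of an extended-valued function. In \<open>ereal\<close> we have \<open>0 * \<infinity> = 0\<close>, so the cases
  \<open>t = 0\<close> and \<open>t = 1\<close> are harmless.
\<close>
definition ext_convex :: "nat \<Rightarrow> ((nat \<Rightarrow> real) \<Rightarrow> ereal) \<Rightarrow> bool" where
  "ext_convex n \<psi> \<longleftrightarrow>
     (\<forall>x\<in>space (lborel_n n). \<psi> x \<noteq> - \<infinity>) \<and>
     (\<forall>x\<in>space (lborel_n n). \<forall>y\<in>space (lborel_n n). \<forall>t\<in>{0..1}.
        \<psi> (\<lambda>i\<in>{..<n}. (1 - t) * x i + t * y i) \<le> ereal (1 - t) * \<psi> x + ereal t * \<psi> y)"

definition exp_minus :: "ereal \<Rightarrow> real" where
  "exp_minus a = (if a = \<infinity> then 0 else exp (- real_of_ereal a))"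

definition log_concave_rv :: "'a measure \<Rightarrow> nat \<Rightarrow> ('a \<Rightarrow> nat \<Rightarrow> real) \<Rightarrow> bool" where
  "log_concave_rv M n X \<longleftrightarrow>
     (\<exists>\<psi>. ext_convex n \<psi> \<and> distributed M (lborel_n n) X (\<lambda>x. ennreal (exp_minus (\<psi> x))))"

definition symmetric_rv :: "'a measure \<Rightarrow> nat \<Rightarrow> ('a \<Rightarrow> nat \<Rightarrow> real) \<Rightarrow> bool" where
  "symmetric_rv M n X \<longleftrightarrow>
     X \<in> measurable M (lborel_n n) \<and>
     distr M (lborel_n n) (\<lambda>\<omega>. \<lambda>i\<in>{..<n}. - X \<omega> i) = distr M (lborel_n n) X"

text \<open>
  \<open>exp (\<kappa> * S(\<langle>w, X\<rangle>))\<close>, understood as \<open>0\<close> for the zero vector \<open>w\<close>.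
\<close>
definition exp_Ent :: "real \<Rightarrow> 'a measure \<Rightarrow> nat \<Rightarrow> (nat \<Rightarrow> real) \<Rightarrow> ('a \<Rightarrow> nat \<Rightarrow> real) \<Rightarrow> real" where
  "exp_Ent \<kappa> M n w X =
     (if \<forall>i<n. w i = 0 then 0 else exp (\<kappa> * Ent M (\<lambda>\<omega>. scalar_prod n w (X \<omega>))))"

definition rev_EPI_vector :: "real \<Rightarrow> 'a measure \<Rightarrow> bool" where
  "rev_EPI_vector \<kappa> M \<longleftrightarrow>
     (\<forall>n\<ge>1. \<forall>X. symmetric_rv M n X \<and> log_concave_rv M n X \<longrightarrow>
        (\<forall>u v. exp_Ent \<kappa> M n (\<lambda>i. u i + v i) X \<le> exp_Ent \<kappa> M n u X + exp_Ent \<kappa> M n v X))"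

definition pair_rv :: "('a \<Rightarrow> real) \<Rightarrow> ('a \<Rightarrow> real) \<Rightarrow> 'a \<Rightarrow> nat \<Rightarrow> real" where
  "pair_rv X Y \<omega> = (\<lambda>i\<in>{..<2}. if i = 0 then X \<omega> else Y \<omega>)"

definition rev_EPI_pair :: "real \<Rightarrow> 'a measure \<Rightarrow> bool" where
  "rev_EPI_pair \<kappa> M \<longleftrightarrow>
     (\<forall>X Y. symmetric_rv M 2 (pair_rv X Y) \<and> log_concave_rv M 2 (pair_rv X Y) \<longrightarrow>
        exp (\<kappa> * Ent M (\<lambda>\<omega>. X \<omega> + Y \<omega>)) \<le> exp (\<kappa> * Ent M X) + exp (\<kappa> * Ent M Y))"

end

theory Submission
  imports Defs
begin

text \<open>
  By the Prekopa-Leindler inequality every one-dimensional projection has an even log-concave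
  density. For such a density \<open>f\<close> of \<open>X\<close> one has
  \<open>2 * E \<bar>X\<bar> \<le> 1 / f 0 \<le> exp (S X) \<le> 2 * exp 1 * E \<bar>X\<bar>\<close>. Put \<open>exp (S Y) = s ^ 5 * exp (S X)\<close> with
  \<open>s \<le> 1\<close>; the claim is \<open>S (X + Y) \<le> S X + 5 * ln (1 + s)\<close>. The triangle inequality in \<open>L\<^sup>1\<close>
  gives \<open>exp (S (X + Y)) \<le> exp 1 * (exp (S X) + exp (S Y))\<close>, and for \<open>s \<ge> 1/4\<close> the factor \<open>exp 1\<close> is
  absorbed since \<open>3 * (1 + s ^ 5) \<le> (1 + s) ^ 5\<close>. For smaller \<open>s\<close> the variable \<open>Y\<close> is a tiny
  perturbation of \<open>X\<close>, and Gibbs' inequality against a dilation of \<open>f\<close> by \<open>1 + s\<^sup>2\<close>, mixed with a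
  Laplace density of weight \<open>s\<close>, bounds the gain of entropy by \<open>4 * s \<le> 5 * ln (1 + s)\<close>.
\<close>

section \<open>The Prekopa-Leindler inequality\<close>

text \<open>The bound from first moments loses a factor \<open>exp 1\<close>, which is fatal as
  \<open>s\<close> tends to 0, where the target \<open>(1 + s) ^ 5\<close> tends to 1; hence the two
  regimes. In the small regime the support of \<open>f\<close> may be bounded, so that
  \<open>X + Y\<close> can leave it, and even inside it \<open>f (X + Y)\<close> may be far smaller
  than \<open>f X\<close>. Dilation cures both for moderate \<open>Y\<close>, since
  \<open>(x + y) / (1 + d)\<close> is a convex combination of \<open>x\<close> and
  \<open>y / d\<close>. For larger \<open>Y\<close> the Laplace part limits the loss to
  \<open>2 - ln s\<close> plus a multiple of \<open>|Y|\<close>, and by Markov's inequality such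
  \<open>Y\<close> are rare. The fifth power leaves enough room: the weight \<open>s\<close> costs
  order \<open>s\<close>, the dilation costs order \<open>s ^ 2\<close>, and the rare event costs at
  most order \<open>s ^ 5 / s ^ 2 / s = s ^ 2\<close>, where \<open>1 / s\<close> bounds the
  logarithm. The threshold \<open>1/4\<close> is close to the limit of the first regime: there
  \<open>(1 + s) ^ 5\<close> is about 3.05 and \<open>3 * (1 + s ^ 5)\<close> about 3.003.\<close>

lemma incseq_cofinal:
  fixes A :: "real set"
  assumes "A \<noteq> {}"
  obtains r where "incseq r" "\<And>n. \<exists>a\<in>A. r n \<le> a" "A \<subseteq> (\<Union>n. {..r n})"
\<comment> \<open>A supremum outside \<open>A\<close> is approached, an attained one is hit at once,
  and an unbounded \<open>A\<close> is exhausted by the naturals. That every \<open>r n\<close> is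
  dominated by a point of \<open>A\<close> lets later limit arguments cut at points of the set
  itself.\<close>
proof (cases "bdd_above A \<and> Sup A \<notin> A")
  case True
  define r where "r n = Sup A - 1 / real (Suc n)" for n
  show thesis
  proof
    show "incseq r"
      unfolding r_def by (intro incseq_SucI) (simp add: field_simps)
    show "\<exists>a\<in>A. r n \<le> a" for n
    proof -
      have "r n < Sup A" by (simp add: r_def)
      then obtain a where "a \<in> A" "r n < a" using assms by (rule less_cSupE)
      then show ?thesis by (intro bexI[of _ a]) auto
    qed
    show "A \<subseteq> (\<Union>n. {..r n})"
    proof
      fix x assume x: "x \<in> A"
      then have "x < Sup A"
        using True cSup_upper[of x A] by (cases "x = Sup A") auto
      then obtain n where "1 / real (Suc n) < Sup A - x"
        using nat_approx_posE[of "Sup A - x"] by (metis diff_gt_0_iff_gt)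
      then have "x \<le> r n" unfolding r_def by linarith
      then show "x \<in> (\<Union>n. {..r n})" by blast
    qed
  qed
next
  case False
  show thesis
  proof (cases "bdd_above A")
    case True
    then have *: "Sup A \<in> A" using False by simp
    show thesis
    proof (rule that[of "\<lambda>_. Sup A"])
      show "A \<subseteq> (\<Union>n. {..Sup A})" using True by (auto intro: cSup_upper)
    qed (use * in \<open>auto simp: incseq_def\<close>)
  next
    case False
    show thesis
    proof (rule that[of real])
      show "\<exists>a\<in>A. real n \<le> a" for n
        using False unfolding bdd_above_def by (meson le_cases)
      show "A \<subseteq> (\<Union>n. {..real n})"
        using real_arch_simple by auto
    qed (simp add: incseq_def)
  qed
qed

text \<open>
  The two halves of \<open>A\<close> and \<open>B\<close> cut off at \<open>a\<close> and \<open>b\<close> are moved into \<open>C\<close>, where they only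
  meet at \<open>(1 - t) * a + t * b\<close>.
\<close>
lemma brunn_minkowski_real:
  fixes A B C :: "real set"
  assumes [measurable]: "A \<in> sets borel" "B \<in> sets borel" "C \<in> sets borel"
    and ne: "A \<noteq> {}" "B \<noteq> {}" and t: "0 < t" "t < 1"
    and sub: "\<And>a b. a \<in> A \<Longrightarrow> b \<in> B \<Longrightarrow> (1 - t) * a + t * b \<in> C"
  shows "ennreal (1 - t) * emeasure lborel A + ennreal t * emeasure lborel B \<le> emeasure lborel C"
proof -
  have cut: "ennreal (1 - t) * emeasure lborel (A \<inter> {..a}) + ennreal t * emeasure lborel (B \<inter> {b..})
      \<le> emeasure lborel C" if ab: "a \<in> A" "b \<in> B" for a b
  proof -
    define m where "m = (1 - t) * a + t * b"
    have "ennreal (1 - t) * emeasure lborel (A \<inter> {..a})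
        = ennreal (1 - t) * (\<integral>\<^sup>+x. indicator (A \<inter> {..a}) x \<partial>lborel)" by simp
    also have "\<dots> \<le> ennreal (1 - t) * (\<integral>\<^sup>+x. indicator (C \<inter> {..m}) (t * b + (1 - t) * x) \<partial>lborel)"
      using sub ab t
      by (intro mult_left_mono nn_integral_mono)
         (auto simp: indicator_def m_def add.commute)
    also have "\<dots> = (\<integral>\<^sup>+x. indicator (C \<inter> {..m}) x \<partial>lborel)"
      using nn_integral_real_affine[of "indicator (C \<inter> {..m})" "1 - t" "t * b"] t by simp
    finally have 1: "ennreal (1 - t) * emeasure lborel (A \<inter> {..a}) \<le> (\<integral>\<^sup>+x. indicator (C \<inter> {..m}) x \<partial>lborel)" .
    have "ennreal t * emeasure lborel (B \<inter> {b..})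
        = ennreal t * (\<integral>\<^sup>+x. indicator (B \<inter> {b..}) x \<partial>lborel)" by simp
    also have "\<dots> \<le> ennreal t * (\<integral>\<^sup>+x. indicator (C \<inter> {m..}) ((1 - t) * a + t * x) \<partial>lborel)"
      using sub ab t
      by (intro mult_left_mono nn_integral_mono)
         (auto simp: indicator_def m_def)
    also have "\<dots> = (\<integral>\<^sup>+x. indicator (C \<inter> {m..}) x \<partial>lborel)"
      using nn_integral_real_affine[of "indicator (C \<inter> {m..})" t "(1 - t) * a"] t by simp
    finally have 2: "ennreal t * emeasure lborel (B \<inter> {b..}) \<le> (\<integral>\<^sup>+x. indicator (C \<inter> {m..}) x \<partial>lborel)" .
    have "(\<integral>\<^sup>+x. indicator (C \<inter> {..m}) x \<partial>lborel) + (\<integral>\<^sup>+x. indicator (C \<inter> {m..}) x \<partial>lborel)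
        = (\<integral>\<^sup>+x. indicator (C \<inter> {..m}) x + indicator (C \<inter> {m..}) x \<partial>lborel)"
      by (rule nn_integral_add[symmetric]) measurable
    also have "\<dots> = (\<integral>\<^sup>+x. indicator C x \<partial>lborel)"
    proof (rule nn_integral_cong_AE, rule AE_mp[OF AE_lborel_singleton[of m]], intro AE_I2 impI)
      fix x :: real assume "x \<noteq> m"
      then show "indicator (C \<inter> {..m}) x + indicator (C \<inter> {m..}) x = (indicator C x :: ennreal)"
        by (auto simp: indicator_def)
    qed
    finally show ?thesis using add_mono[OF 1 2] by simp
  qed
  obtain r where r: "incseq r" "\<And>n. \<exists>a\<in>A. r n \<le> a" "A \<subseteq> (\<Union>n. {..r n})"
    using incseq_cofinal[OF ne(1)] by blast
  \<comment> \<open>Reflection turns the exhaustion by lower half-lines into an exhaustion of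
    \<open>B\<close> by the upper half-lines \<open>{- q n..}\<close>.\<close>
  obtain q where q: "incseq q" "\<And>n. \<exists>a\<in>uminus ` B. q n \<le> a" "uminus ` B \<subseteq> (\<Union>n. {..q n})"
    using incseq_cofinal[of "uminus ` B"] ne(2) by auto
  have UA: "(\<Union>n. A \<inter> {..r n}) = A" using r(3) by auto
  have UB: "(\<Union>n. B \<inter> {- q n..}) = B"
  proof -
    have "\<exists>n. - q n \<le> x" if "x \<in> B" for x
      using subsetD[OF q(3), of "- x"] that by (auto simp: minus_le_iff)
    then show ?thesis by auto
  qed
  have limA: "(\<lambda>n. emeasure lborel (A \<inter> {..r n})) \<longlonglongrightarrow> emeasure lborel (\<Union>n. A \<inter> {..r n})"
    using r(1) by (intro Lim_emeasure_incseq) (auto simp: incseq_def intro: order_trans)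
  have limB: "(\<lambda>n. emeasure lborel (B \<inter> {- q n..})) \<longlonglongrightarrow> emeasure lborel (\<Union>n. B \<inter> {- q n..})"
    using q(1) by (intro Lim_emeasure_incseq) (auto simp: incseq_def, meson neg_le_iff_le order_trans)
  have "(\<lambda>n. ennreal (1 - t) * emeasure lborel (A \<inter> {..r n}) + ennreal t * emeasure lborel (B \<inter> {- q n..}))
    \<longlonglongrightarrow> ennreal (1 - t) * emeasure lborel A + ennreal t * emeasure lborel B"
    using limA limB unfolding UA UB by (intro tendsto_add ennreal_tendsto_cmult) auto
  then show ?thesis
  \<comment> \<open>Moving the two cuts outwards to actual points of \<open>A\<close> and
    \<open>B\<close> only enlarges the pieces, and \<open>cut\<close> applies to such
    points.\<close>
  proof (rule LIMSEQ_le_const2, intro exI[of _ 0] allI impI)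
    fix n :: nat
    obtain a where a: "a \<in> A" "r n \<le> a" using r(2)[of n] by auto
    obtain b where b: "b \<in> B" "b \<le> - q n"
      using q(2)[of n] by (auto simp: le_minus_iff)
    note ab = a b
    have "ennreal (1 - t) * emeasure lborel (A \<inter> {..r n}) + ennreal t * emeasure lborel (B \<inter> {- q n..})
      \<le> ennreal (1 - t) * emeasure lborel (A \<inter> {..a}) + ennreal t * emeasure lborel (B \<inter> {b..})"
      using ab by (intro add_mono mult_left_mono emeasure_mono) auto
    also have "\<dots> \<le> emeasure lborel C" by (rule cut[OF ab(1,3)])
    finally show "ennreal (1 - t) * emeasure lborel (A \<inter> {..r n}) + ennreal t * emeasure lborel (B \<inter> {- q n..})
      \<le> emeasure lborel C" .
  qed
qed

text \<open>
  Says that \<open>a powr (1 - t) * b powr t \<le> c\<close>, with the left-hand side \<open>0\<close> if \<open>a\<close> or \<open>b\<close> is \<open>0\<close>;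
  this spares a real power on \<^typ>\<open>ennreal\<close>.
\<close>
definition geo_mean_le :: "real \<Rightarrow> ennreal \<Rightarrow> ennreal \<Rightarrow> ennreal \<Rightarrow> bool" where
  "geo_mean_le t a b c \<longleftrightarrow>
    (\<forall>\<alpha> \<beta>. 0 < \<alpha> \<longrightarrow> 0 < \<beta> \<longrightarrow> ennreal \<alpha> < a \<longrightarrow> ennreal \<beta> < b \<longrightarrow>
      ennreal (\<alpha> powr (1 - t) * \<beta> powr t) \<le> c)"

lemma geo_mean_leD:
  "geo_mean_le t a b c \<Longrightarrow> 0 < \<alpha> \<Longrightarrow> 0 < \<beta> \<Longrightarrow> ennreal \<alpha> < a \<Longrightarrow> ennreal \<beta> < b \<Longrightarrow>
    ennreal (\<alpha> powr (1 - t) * \<beta> powr t) \<le> c"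
  by (simp add: geo_mean_le_def)

text \<open>A common factor passes through because the exponents sum to 1. It will be the Jacobian
  factor in the density of a projection.\<close>

lemma geo_mean_le_cmult:
  assumes "geo_mean_le t a b d" and c: "0 < (c::real)"
  shows "geo_mean_le t (ennreal c * a) (ennreal c * b) (ennreal c * d)"
  unfolding geo_mean_le_def
proof (intro allI impI)
  fix \<alpha> \<beta> :: real
  assume *: "0 < \<alpha>" "0 < \<beta>" "ennreal \<alpha> < ennreal c * a" "ennreal \<beta> < ennreal c * b"
  have less: "ennreal (\<gamma> / c) < e" if "0 < \<gamma>" "ennreal \<gamma> < ennreal c * e" for \<gamma> e
  proof (rule ccontr)
    assume "\<not> ennreal (\<gamma> / c) < e"
    then have "ennreal c * e \<le> ennreal c * ennreal (\<gamma> / c)"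
      by (intro mult_left_mono) auto
    also have "\<dots> = ennreal \<gamma>" using that c by (simp flip: ennreal_mult)
    finally show False using that by simp
  qed
  have "ennreal ((\<alpha> / c) powr (1 - t) * (\<beta> / c) powr t) \<le> d"
    using * c by (intro geo_mean_leD[OF assms(1)] less) auto
  then have "ennreal c * ennreal ((\<alpha> / c) powr (1 - t) * (\<beta> / c) powr t) \<le> ennreal c * d"
    by (intro mult_left_mono) auto
  also have "ennreal c * ennreal ((\<alpha> / c) powr (1 - t) * (\<beta> / c) powr t)
      = ennreal (\<alpha> powr (1 - t) * \<beta> powr t)"
  proof -
    have "c powr (1 - t) * c powr t = c" using c by (simp flip: powr_add)
    then show ?thesis
      using * c by (simp add: powr_divide flip: ennreal_mult)
  qed
  finally show "ennreal (\<alpha> powr (1 - t) * \<beta> powr t) \<le> ennreal c * d" .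
qed

text \<open>Tonelli for the region below the truncated graph. Writing the level as
  \<open>c * r\<close> puts all functions on one interval of relative levels \<open>r\<close>, so
  that functions truncated at different heights can be compared level by level.\<close>

lemma layer_cake:
  fixes f :: "real \<Rightarrow> ennreal"
  assumes [measurable]: "f \<in> borel_measurable borel" and c: "0 < (c::real)"
  shows "(\<integral>\<^sup>+x. min (f x) (ennreal c) \<partial>lborel) =
    ennreal c * (\<integral>\<^sup>+r. indicator {0<..<1} r * emeasure lborel {x. ennreal (c * r) < f x} \<partial>lborel)"
proof -
  have "min (f x) (ennreal c) = (\<integral>\<^sup>+r. indicator {0<..<c} r * indicator {r. ennreal r < f x} r \<partial>lborel)" for x
  proof -
    have "(\<integral>\<^sup>+r. indicator {0<..<c} r * indicator {r. ennreal r < f x} r \<partial>lborel)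
      = (\<integral>\<^sup>+r. indicator ({0<..<c} \<inter> {r. ennreal r < f x}) r \<partial>lborel)"
      by (simp only: indicator_inter_arith)
    also have "\<dots> = emeasure lborel ({0<..<c} \<inter> {r. ennreal r < f x})"
      by (rule nn_integral_indicator) measurable
    also have "\<dots> = min (f x) (ennreal c)"
    proof (cases "f x")
      case (real v)
      have "{0<..<c} \<inter> {r. ennreal r < f x} = {0<..<min c v}"
        using real by (auto simp: ennreal_less_iff)
      then show ?thesis
        using real c by (simp add: min_def ennreal_le_iff)
    next
      case top
      then have "{0<..<c} \<inter> {r. ennreal r < f x} = {0<..<c}" by auto
      then show ?thesis using top c by simp
    qed
    finally show ?thesis by simp
  qed
  then have "(\<integral>\<^sup>+x. min (f x) (ennreal c) \<partial>lborel)
    = (\<integral>\<^sup>+x. \<integral>\<^sup>+r. indicator {0<..<c} r * indicator {r. ennreal r < f x} r \<partial>lborel \<partial>lborel)"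
    by simp
  also have "\<dots> = (\<integral>\<^sup>+r. \<integral>\<^sup>+x. indicator {0<..<c} r * indicator {r. ennreal r < f x} r \<partial>lborel \<partial>lborel)"
    by (rule lborel_pair.Fubini') measurable
  also have "\<dots> = (\<integral>\<^sup>+r. indicator {0<..<c} r * emeasure lborel {x. ennreal r < f x} \<partial>lborel)"
  proof (rule nn_integral_cong)
    fix r
    have "(\<integral>\<^sup>+x. indicator {0<..<c} r * indicator {r. ennreal r < f x} r \<partial>lborel)
      = indicator {0<..<c} r * (\<integral>\<^sup>+x. indicator {x. ennreal r < f x} x \<partial>lborel)"
      by (subst nn_integral_cmult[symmetric]) (auto intro!: nn_integral_cong simp: indicator_def)
    then show "(\<integral>\<^sup>+x. indicator {0<..<c} r * indicator {r. ennreal r < f x} r \<partial>lborel)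
      = indicator {0<..<c} r * emeasure lborel {x. ennreal r < f x}" by simp
  qed
  also have "\<dots> = ennreal c * (\<integral>\<^sup>+r. indicator {0<..<c} (c * r) * emeasure lborel {x. ennreal (c * r) < f x} \<partial>lborel)"
    using nn_integral_real_affine[of "\<lambda>r. indicator {0<..<c} r * emeasure lborel {x. ennreal r < f x}" c 0] c
    by simp
  finally have "(\<integral>\<^sup>+x. min (f x) (ennreal c) \<partial>lborel) = ennreal c *
    (\<integral>\<^sup>+r. indicator {0<..<c} (c * r) * emeasure lborel {x. ennreal (c * r) < f x} \<partial>lborel)" .
  moreover have "indicator {0<..<c} (c * r) = (indicator {0<..<1} r :: ennreal)" for r
    using c by (auto simp: indicator_def zero_less_mult_iff)
  ultimately show ?thesis by (simp only:)
qed

text \<open>Monotone convergence along levels cofinal in those that \<open>f\<close> strictly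
  exceeds somewhere. Strictness keeps all superlevel sets up to \<open>c\<close> nonempty, as
  Brunn-Minkowski requires, and an infinite supremum is covered as well.\<close>

lemma nn_integral_truncate:
  fixes f :: "'a \<Rightarrow> ennreal"
  assumes [measurable]: "f \<in> borel_measurable N" and \<alpha>: "0 < \<alpha>" "ennreal \<alpha> < (\<integral>\<^sup>+x. f x \<partial>N)"
  obtains c :: real and x where "0 < c" "ennreal c < f x" "ennreal \<alpha> < (\<integral>\<^sup>+x. min (f x) (ennreal c) \<partial>N)"
proof -
  define R where "R = {c. \<exists>x. ennreal c < f x}"
  have "R \<noteq> {}"
  proof
    assume "R = {}"
    then have "f x = 0" for x
      by (auto simp: R_def not_less dest!: spec[of _ 0])
    then show False using \<alpha> by simp
  qed
  then obtain r where r: "incseq r" "\<And>n. \<exists>a\<in>R. r n \<le> a" "R \<subseteq> (\<Union>n. {..r n})"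
    using incseq_cofinal[of R] by blast
  have "f x = (SUP n. min (f x) (ennreal (r n)))" for x
  proof (rule antisym)
    show "f x \<le> (SUP n. min (f x) (ennreal (r n)))"
    proof (rule dense_le)
      fix y assume y: "y < f x"
      then obtain c where c: "y = ennreal c" by (cases y) auto
      with y have "c \<in> R" by (auto simp: R_def)
      then obtain n where "c \<le> r n" using r(3) by auto
      then have "y \<le> min (f x) (ennreal (r n))"
        using y c by (auto simp: less_imp_le intro: ennreal_leI)
      then show "y \<le> (SUP n. min (f x) (ennreal (r n)))"
        by (rule order_trans) (auto intro: SUP_upper)
    qed
  qed (auto intro: SUP_least)
  then have "(\<integral>\<^sup>+x. f x \<partial>N) = (\<integral>\<^sup>+x. (SUP n. min (f x) (ennreal (r n))) \<partial>N)" by simp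
  also have "\<dots> = (SUP n. \<integral>\<^sup>+x. min (f x) (ennreal (r n)) \<partial>N)"
    using r(1)
    by (intro nn_integral_monotone_convergence_SUP)
       (auto simp: incseq_def le_fun_def intro!: min.coboundedI2 ennreal_leI)
  finally obtain n where n: "ennreal \<alpha> < (\<integral>\<^sup>+x. min (f x) (ennreal (r n)) \<partial>N)"
    using \<alpha>(2) by (auto simp: less_SUP_iff)
  have "0 < r n"
  proof (rule ccontr)
    assume "\<not> 0 < r n"
    then have "min (f x) (ennreal (r n)) = 0" for x by (simp add: ennreal_neg)
    with n show False by simp
  qed
  moreover obtain a x where "r n \<le> a" "ennreal a < f x"
    using r(2)[of n] by (auto simp: R_def)
  then have "ennreal (r n) < f x"
    by (rule le_less_trans[OF ennreal_leI])
  ultimately show thesis using n that by blast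
qed


text \<open>At each relative level the superlevel sets of \<open>f\<close> and \<open>g\<close>
  combine inside that of \<open>h\<close>, so Brunn-Minkowski bounds its measure. Integration over
  the levels gives an arithmetic mean of the normalised integrals, which Young's inequality weakens
  to the geometric mean.\<close>

lemma prekopa_leindler_real:
  fixes f g h :: "real \<Rightarrow> ennreal"
  assumes [measurable]: "f \<in> borel_measurable borel" "g \<in> borel_measurable borel" "h \<in> borel_measurable borel"
    and t: "0 < t" "t < 1"
    and le: "\<And>x y. geo_mean_le t (f x) (g y) (h ((1 - t) * x + t * y))"
  shows "geo_mean_le t (\<integral>\<^sup>+x. f x \<partial>lborel) (\<integral>\<^sup>+x. g x \<partial>lborel) (\<integral>\<^sup>+x. h x \<partial>lborel)"
  unfolding geo_mean_le_def
proof (intro allI impI)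
  fix \<alpha> \<beta> :: real
  assume \<alpha>: "0 < \<alpha>" "ennreal \<alpha> < (\<integral>\<^sup>+x. f x \<partial>lborel)" and \<beta>: "0 < \<beta>" "ennreal \<beta> < (\<integral>\<^sup>+x. g x \<partial>lborel)"
  obtain a x0 where a: "0 < a" "ennreal a < f x0" "ennreal \<alpha> < (\<integral>\<^sup>+x. min (f x) (ennreal a) \<partial>lborel)"
    using nn_integral_truncate[OF _ \<alpha>] by auto
  obtain b y0 where b: "0 < b" "ennreal b < g y0" "ennreal \<beta> < (\<integral>\<^sup>+x. min (g x) (ennreal b) \<partial>lborel)"
    using nn_integral_truncate[OF _ \<beta>] by auto
  \<comment> \<open>The levels \<open>a * r\<close> and \<open>b * r\<close> have geometric mean
    \<open>c * r\<close>, since the exponents sum to 1.\<close>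
  define c where "c = a powr (1 - t) * b powr t"
  have c: "0 < c" using a b by (simp add: c_def)
  define L where "L m u = (\<integral>\<^sup>+r. indicator {0<..<1} r * emeasure lborel {x. ennreal (m * r) < u x} \<partial>lborel)"
    for m :: real and u :: "real \<Rightarrow> ennreal"
  have L_ge: "ennreal (\<gamma> / m) \<le> L m u"
    if "u \<in> borel_measurable borel" "0 < m" "0 < \<gamma>" "ennreal \<gamma> < (\<integral>\<^sup>+x. min (u x) (ennreal m) \<partial>lborel)" for \<gamma> m u
  proof (rule ccontr)
    assume "\<not> ennreal (\<gamma> / m) \<le> L m u"
    then have "ennreal m * L m u \<le> ennreal m * ennreal (\<gamma> / m)"
      by (intro mult_left_mono) auto
    also have "\<dots> = ennreal \<gamma>" using that(2,3) by (simp flip: ennreal_mult)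
    finally show False
      using that(4) unfolding layer_cake[OF that(1,2)] L_def by simp
  qed
  \<comment> \<open>For \<open>r < 1\<close> both level sets are nonempty, as \<open>a\<close> and \<open>b\<close> are below the suprema of \<open>f\<close> and \<open>g\<close>.\<close>
  have slice: "ennreal (1 - t) * emeasure lborel {x. ennreal (a * r) < f x} + ennreal t * emeasure lborel {x. ennreal (b * r) < g x}
      \<le> emeasure lborel {x. ennreal (c * r) < h x}" if r: "0 < r" "r < 1" for r
  proof (rule brunn_minkowski_real)
    have "a * r \<le> a" "b * r \<le> b" using a(1) b(1) r by auto
    then show "{x. ennreal (a * r) < f x} \<noteq> {}" "{x. ennreal (b * r) < g x} \<noteq> {}"
      using a(2) b(2) by (auto intro: le_less_trans[OF ennreal_leI])
  next
    fix x y assume xy: "x \<in> {x. ennreal (a * r) < f x}" "y \<in> {x. ennreal (b * r) < g x}"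
    \<comment> \<open>\<open>geo_mean_le\<close> yields only a weak inequality for \<open>h\<close>.
      Raising both levels slightly, which strict membership allows, gives the strict one that
      defines the level set.\<close>
    have approx: "\<exists>\<gamma>>m. ennreal \<gamma> < e" if "ennreal m < e" "0 < m" for m e
    proof -
      obtain d where d: "ennreal m < d" "d < e" using dense \<open>ennreal m < e\<close> by blast
      then obtain \<gamma> where "0 \<le> \<gamma>" "d = ennreal \<gamma>" by (cases d) auto
      then show ?thesis using d \<open>0 < m\<close> by (auto simp: ennreal_less_iff)
    qed
    have pos: "0 < a * r" "0 < b * r" using a b r by auto
    obtain p q where p: "a * r < p" "ennreal p < f x" and q: "b * r < q" "ennreal q < g y"
      using approx[of "a * r" "f x"] approx[of "b * r" "g y"] xy pos by auto
    have "c * r = (a * r) powr (1 - t) * (b * r) powr t"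
      using a b r by (simp add: c_def powr_mult flip: powr_add)
    also have "\<dots> < p powr (1 - t) * q powr t"
      using p q pos t by (intro mult_strict_mono powr_less_mono2) auto
    finally have "ennreal (c * r) < ennreal (p powr (1 - t) * q powr t)"
      using p(1) q(1) pos by (intro ennreal_lessI) auto
    also have "\<dots> \<le> h ((1 - t) * x + t * y)"
      using p q pos by (intro geo_mean_leD[OF le]) auto
    finally show "(1 - t) * x + t * y \<in> {x. ennreal (c * r) < h x}" by simp
  qed (use t in auto)
  have L_meas: "(\<lambda>r. emeasure lborel {x. ennreal (m * r) < u x}) \<in> borel_measurable lborel"
    if [measurable]: "u \<in> borel_measurable borel" for m :: real and u :: "real \<Rightarrow> ennreal"
  proof -
    have "(\<lambda>r. \<integral>\<^sup>+x. indicator {x. ennreal (m * r) < u x} x \<partial>lborel) \<in> borel_measurable lborel"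
      by measurable
    then show ?thesis by simp
  qed
  have "ennreal (1 - t) * L a f + ennreal t * L b g \<le> L c h"
  proof -
    have "ennreal (1 - t) * L a f + ennreal t * L b g =
      (\<integral>\<^sup>+r. ennreal (1 - t) * (indicator {0<..<1} r * emeasure lborel {x. ennreal (a * r) < f x})
        + ennreal t * (indicator {0<..<1} r * emeasure lborel {x. ennreal (b * r) < g x}) \<partial>lborel)"
      unfolding L_def using L_meas[of f a] L_meas[of g b]
      by (subst nn_integral_add) (auto simp: nn_integral_cmult)
    also have "\<dots> \<le> L c h"
      unfolding L_def by (intro nn_integral_mono) (auto simp: indicator_def slice)
    finally show ?thesis .
  qed
  moreover have "ennreal (1 - t) * ennreal (\<alpha> / a) + ennreal t * ennreal (\<beta> / b) \<le> ennreal (1 - t) * L a f + ennreal t * L b g"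
    using L_ge a b \<alpha> \<beta> by (intro add_mono mult_left_mono) auto
  moreover have "ennreal ((1 - t) * (\<alpha> / a) + t * (\<beta> / b)) = ennreal (1 - t) * ennreal (\<alpha> / a) + ennreal t * ennreal (\<beta> / b)"
    using t a b \<alpha> \<beta> by (simp add: ennreal_mult'' flip: ennreal_mult)
  ultimately have "ennreal ((1 - t) * (\<alpha> / a) + t * (\<beta> / b)) \<le> L c h"
    by order
  then have "ennreal c * ennreal ((1 - t) * (\<alpha> / a) + t * (\<beta> / b)) \<le> ennreal c * L c h"
    by (intro mult_left_mono) auto
  also have "\<dots> = (\<integral>\<^sup>+x. min (h x) (ennreal c) \<partial>lborel)"
    unfolding L_def using c by (subst layer_cake) auto
  also have "\<dots> \<le> (\<integral>\<^sup>+x. h x \<partial>lborel)"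
    by (intro nn_integral_mono) auto
  finally have 1: "ennreal (c * ((1 - t) * (\<alpha> / a) + t * (\<beta> / b))) \<le> (\<integral>\<^sup>+x. h x \<partial>lborel)"
    using c t a b \<alpha> \<beta> by (subst ennreal_mult) auto
  have 2: "\<alpha> powr (1 - t) * \<beta> powr t \<le> c * ((1 - t) * (\<alpha> / a) + t * (\<beta> / b))"
  proof -
    have "\<alpha> powr (1 - t) * \<beta> powr t = c * ((\<alpha> / a) powr (1 - t) * (\<beta> / b) powr t)"
      using a b \<alpha> \<beta> by (simp add: c_def powr_divide)
    also have "\<dots> \<le> c * ((1 - t) * (\<alpha> / a) + t * (\<beta> / b))"
      using a b \<alpha> \<beta> t c by (intro mult_left_mono Youngs_inequality_0) auto
    finally show ?thesis .
  qed
  show "ennreal (\<alpha> powr (1 - t) * \<beta> powr t) \<le> (\<integral>\<^sup>+x. h x \<partial>lborel)"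
    by (rule order_trans[OF ennreal_leI[OF 2] 1])
qed

text \<open>Induction on the coordinates: the one-dimensional inequality in the new coordinate says
  precisely that the partial integrals satisfy the hypothesis again.\<close>

lemma prekopa_leindler_PiM:
  fixes f g h :: "('i \<Rightarrow> real) \<Rightarrow> ennreal"
  assumes "finite I" and t: "0 < t" "t < 1"
    and "f \<in> borel_measurable (\<Pi>\<^sub>M i\<in>I. lborel)" "g \<in> borel_measurable (\<Pi>\<^sub>M i\<in>I. lborel)"
      "h \<in> borel_measurable (\<Pi>\<^sub>M i\<in>I. lborel)"
    and "\<And>x y. x \<in> extensional I \<Longrightarrow> y \<in> extensional I \<Longrightarrow>
      geo_mean_le t (f x) (g y) (h (\<lambda>i\<in>I. (1 - t) * x i + t * y i))"
  shows "geo_mean_le t (\<integral>\<^sup>+x. f x \<partial>(\<Pi>\<^sub>M i\<in>I. lborel)) (\<integral>\<^sup>+x. g x \<partial>(\<Pi>\<^sub>M i\<in>I. lborel))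
    (\<integral>\<^sup>+x. h x \<partial>(\<Pi>\<^sub>M i\<in>I. lborel))"
  using assms(1,4-)
proof (induction I arbitrary: f g h rule: finite_induct)
  case empty
  interpret product_sigma_finite "\<lambda>_. lborel :: real measure" by standard
  show ?case
    \<comment> \<open>The empty product has the constantly \<open>undefined\<close> function as its
      only point, so the integrals are values there.\<close>
    using empty(4)[of "\<lambda>_. undefined" "\<lambda>_. undefined"]
    by (simp add: nn_integral_empty restrict_def)
next
  case (insert i I)
  interpret product_sigma_finite "\<lambda>_. lborel :: real measure" by standard
  note [measurable] = insert.prems(1-3)
  have upd: "u \<in> borel_measurable (\<Pi>\<^sub>M i\<in>insert i I. lborel) \<Longrightarrow>
    (\<lambda>(x, y). u (x(i := y))) \<in> borel_measurable ((\<Pi>\<^sub>M i\<in>I. lborel) \<Otimes>\<^sub>M lborel)"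
    for u :: "('i \<Rightarrow> real) \<Rightarrow> ennreal"
    using measurable_compose[OF measurable_add_dim] by (simp add: case_prod_beta')
  have inner: "(\<lambda>x. \<integral>\<^sup>+y. u (x(i := y)) \<partial>lborel) \<in> borel_measurable (\<Pi>\<^sub>M i\<in>I. lborel)"
    if "u \<in> borel_measurable (\<Pi>\<^sub>M i\<in>insert i I. lborel)" for u :: "('i \<Rightarrow> real) \<Rightarrow> ennreal"
    using lborel.borel_measurable_nn_integral[OF upd[OF that]] by simp
  have measurable_section: "(\<lambda>y. u (x(i := y))) \<in> borel_measurable borel"
    if "u \<in> borel_measurable (\<Pi>\<^sub>M i\<in>insert i I. lborel)" "x \<in> extensional I" for u :: "('i \<Rightarrow> real) \<Rightarrow> ennreal" and x
    using measurable_Pair2[OF upd[OF that(1)], of x] that(2)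
    by (simp add: space_PiM PiE_def)
  have "geo_mean_le t
    (\<integral>\<^sup>+x. \<integral>\<^sup>+y. f (x(i := y)) \<partial>lborel \<partial>(\<Pi>\<^sub>M i\<in>I. lborel))
    (\<integral>\<^sup>+x. \<integral>\<^sup>+y. g (x(i := y)) \<partial>lborel \<partial>(\<Pi>\<^sub>M i\<in>I. lborel))
    (\<integral>\<^sup>+x. \<integral>\<^sup>+y. h (x(i := y)) \<partial>lborel \<partial>(\<Pi>\<^sub>M i\<in>I. lborel))"
  proof (intro insert.IH inner insert.prems(1-3))
    fix x y :: "'i \<Rightarrow> real"
    assume xy: "x \<in> extensional I" "y \<in> extensional I"
    let ?z = "\<lambda>j\<in>I. (1 - t) * x j + t * y j"
    show "geo_mean_le t (\<integral>\<^sup>+a. f (x(i := a)) \<partial>lborel) (\<integral>\<^sup>+a. g (y(i := a)) \<partial>lborel)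
      (\<integral>\<^sup>+a. h (?z(i := a)) \<partial>lborel)"
    proof (intro prekopa_leindler_real measurable_section insert.prems(1-3) t xy)
      fix a b :: real
      have eq: "(\<lambda>j\<in>insert i I. (1 - t) * (x(i := a)) j + t * (y(i := b)) j) = ?z(i := (1 - t) * a + t * b)"
        using insert.hyps by (auto simp: fun_eq_iff restrict_def)
      show "geo_mean_le t (f (x(i := a))) (g (y(i := b))) (h (?z(i := (1 - t) * a + t * b)))"
        unfolding eq[symmetric] using xy
        by (intro insert.prems(4)) (auto simp: extensional_def)
    qed (auto simp: extensional_def)
  qed
  then show ?case
    using insert.hyps by (simp add: product_nn_integral_insert)
qed


section \<open>Even log-concave densities on the line\<close>

lemma nn_integral_even:
  assumes [measurable]: "g \<in> borel_measurable borel" and even: "\<And>x::real. g (- x) = (g x :: ennreal)"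
  shows "(\<integral>\<^sup>+x. g x \<partial>lborel) = 2 * (\<integral>\<^sup>+x. g x * indicator {0..} x \<partial>lborel)"
proof -
  have "(\<integral>\<^sup>+x. g x \<partial>lborel) = (\<integral>\<^sup>+x. g x * indicator {0..} x + g x * indicator {..0} x \<partial>lborel)"
  proof (rule nn_integral_cong_AE, rule AE_mp[OF AE_lborel_singleton[of 0]], intro AE_I2 impI)
    fix x :: real assume "x \<noteq> 0"
    then show "g x = g x * indicator {0..} x + g x * indicator {..0} x"
      by (cases "0 \<le> x") simp_all
  qed
  also have "\<dots> = (\<integral>\<^sup>+x. g x * indicator {0..} x \<partial>lborel) + (\<integral>\<^sup>+x. g x * indicator {..0} x \<partial>lborel)"
    by (rule nn_integral_add) auto
  also have "(\<integral>\<^sup>+x. g x * indicator {..0} x \<partial>lborel) = (\<integral>\<^sup>+x. g x * indicator {0..} x \<partial>lborel)"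
  proof -
    have "(\<integral>\<^sup>+x. g x * indicator {..0} x \<partial>lborel) = (\<integral>\<^sup>+x. g (- x) * indicator {..0} (- x) \<partial>lborel)"
      using nn_integral_real_affine[of "\<lambda>x. g x * indicator {..0} x" "-1" 0] by simp
    also have "\<dots> = (\<integral>\<^sup>+x. g x * indicator {0..} x \<partial>lborel)"
      by (intro nn_integral_cong) (simp add: even indicator_def)
    finally show ?thesis .
  qed
  finally show ?thesis by (simp add: mult_2)
qed

text \<open>As \<open>0 powr t = 0\<close>, the multiplicative form is trivial where
  \<open>f\<close> vanishes, so bounded supports are included without a logarithm of 0. Evenness and
  log-concavity hold at every point, which makes \<open>f 0\<close> a true maximum.\<close>

locale even_log_concave_density =
  fixes f :: "real \<Rightarrow> real"
  assumes measurable_f[measurable]: "f \<in> borel_measurable borel"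
    and nonneg: "0 \<le> f x"
    and even: "f (- x) = f x"
    and log_concave: "0 < t \<Longrightarrow> t < 1 \<Longrightarrow> f x powr (1 - t) * f y powr t \<le> f ((1 - t) * x + t * y)"
    and nn_integral_eq_1: "(\<integral>\<^sup>+x. ennreal (f x) \<partial>lborel) = 1"
begin

lemma le_max: "f x \<le> f 0"
proof -
  have "f x powr (1 - 1/2) * f (- x) powr (1/2) \<le> f ((1 - 1/2) * x + (1/2) * (- x))"
    by (rule log_concave) auto
  then show ?thesis
    using nonneg[of x] by (simp add: even powr_half_sqrt)
qed

lemma max_pos: "0 < f 0"
proof (rule ccontr)
  assume "\<not> 0 < f 0"
  then have "f x = 0" for x
    using le_max[of x] nonneg[of x] by linarith
  with nn_integral_eq_1 show False by simp
qed

text \<open>Both \<open>x\<close> and \<open>y\<close> lie on the segment from 0 to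
  \<open>x + y\<close>, with complementary weights, so the powers multiply up to the two endpoint
  values. Laplace densities give equality.\<close>

lemma submultiplicative:
  assumes "0 \<le> x" "0 \<le> y"
  shows "f (x + y) * f 0 \<le> f x * f y"
proof (cases "x = 0 \<or> y = 0 \<or> f (x + y) = 0")
  case True
  then show ?thesis using nonneg by (auto simp: mult.commute)
next
  case False
  define t where "t = x / (x + y)"
  have t: "0 < t" "t < 1" "t * (x + y) = x" "(1 - t) * (x + y) = y"
    using False assms by (auto simp: t_def field_simps)
  have pos: "0 < f (x + y)"
    using False nonneg[of "x + y"] by linarith
  have 1: "f 0 powr (1 - t) * f (x + y) powr t \<le> f x"
    using log_concave[of t 0 "x + y"] t by simp
  have 2: "f 0 powr t * f (x + y) powr (1 - t) \<le> f y"
    using log_concave[of "1 - t" 0 "x + y"] t by simp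
  have "f (x + y) * f 0 = (f 0 powr (1 - t) * f 0 powr t) * (f (x + y) powr t * f (x + y) powr (1 - t))"
    using pos max_pos by (simp flip: powr_add)
  also have "\<dots> = (f 0 powr (1 - t) * f (x + y) powr t) * (f 0 powr t * f (x + y) powr (1 - t))"
    by simp
  also have "\<dots> \<le> f x * f y"
    by (intro mult_mono 1 2) (auto simp: nonneg)
  finally show ?thesis .
qed

lemma antimono:
  assumes "0 \<le> y" "y \<le> x"
  shows "f x \<le> f y"
proof -
  have "f x * f 0 \<le> f y * f (x - y)"
    using submultiplicative[of y "x - y"] assms by simp
  also have "\<dots> \<le> f y * f 0"
    by (intro mult_left_mono le_max nonneg)
  finally show ?thesis using max_pos by simp
qed

lemma nn_integral_half: "(\<integral>\<^sup>+x. ennreal (f x) * indicator {0..} x \<partial>lborel) = ennreal (1/2)"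
proof -
  have "2 * (\<integral>\<^sup>+x. ennreal (f x) * indicator {0..} x \<partial>lborel) = 1"
    using nn_integral_even[of "\<lambda>x. ennreal (f x)"] nn_integral_eq_1 by (simp add: even)
  then obtain r where "(\<integral>\<^sup>+x. ennreal (f x) * indicator {0..} x \<partial>lborel) = ennreal r" "2 * r = 1"
    by (cases "\<integral>\<^sup>+x. ennreal (f x) * indicator {0..} x \<partial>lborel")
       (auto simp: ennreal_mult_top simp flip: ennreal_numeral ennreal_mult ennreal_1)
  moreover from this have "r = 1/2" by simp
  ultimately show ?thesis by (simp only:)
qed

lemma nn_integral_shift:
  "(\<integral>\<^sup>+y. ennreal (f (x + y)) * indicator {0..} y \<partial>lborel) =
    (\<integral>\<^sup>+s. ennreal (f s) * indicator {x..} s \<partial>lborel)"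
  using nn_integral_real_affine[of "\<lambda>s. ennreal (f s) * indicator {x..} s" 1 x]
  by (simp add: indicator_def)

text \<open>Submultiplicativity integrated over \<open>y \<ge> 0\<close>, where \<open>f\<close> has
  mass 1/2. It bounds the ratio of density to tail from below by \<open>2 * f 0\<close>, the
  constant value of this ratio on the half-line for a Laplace density.\<close>

lemma tail_le:
  assumes "0 \<le> x"
  shows "ennreal (f 0) * (\<integral>\<^sup>+s. ennreal (f s) * indicator {x..} s \<partial>lborel) \<le> ennreal (f x) * ennreal (1/2)"
proof -
  have "ennreal (f 0) * (\<integral>\<^sup>+s. ennreal (f s) * indicator {x..} s \<partial>lborel)
      = (\<integral>\<^sup>+y. ennreal (f 0) * (ennreal (f (x + y)) * indicator {0..} y) \<partial>lborel)"
    by (simp add: nn_integral_cmult flip: nn_integral_shift)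
  also have "\<dots> \<le> (\<integral>\<^sup>+y. ennreal (f x) * (ennreal (f y) * indicator {0..} y) \<partial>lborel)"
    using submultiplicative[OF assms]
    by (intro nn_integral_mono) (auto simp: indicator_def mult.commute nonneg intro!: ennreal_leI simp flip: ennreal_mult)
  also have "\<dots> = ennreal (f x) * ennreal (1/2)"
    by (simp add: nn_integral_cmult nn_integral_half)
  finally show ?thesis .
qed

text \<open>Integrate \<open>f (x + y) * f 0 \<le> f x * f y\<close> over \<open>x, y \<ge> 0\<close>.\<close>
lemma abs_moment_nn: "(\<integral>\<^sup>+x. ennreal (\<bar>x\<bar> * f x) \<partial>lborel) \<le> ennreal (1 / (2 * f 0))"
proof -
  let ?I = "\<integral>\<^sup>+x. ennreal (\<bar>x\<bar> * f x) * indicator {0..} x \<partial>lborel"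
  \<comment> \<open>The factor \<open>s\<close> is the length of \<open>{0..s}\<close>; Tonelli then
    turns the moment into an integral of tails, to which \<open>tail_le\<close> applies.\<close>
  have "ennreal (f 0) * ?I
      = ennreal (f 0) * (\<integral>\<^sup>+s. (\<integral>\<^sup>+x. ennreal (f s) * (indicator {0..s} x) \<partial>lborel) \<partial>lborel)"
  proof (intro arg_cong2[where f = "(*)"] nn_integral_cong refl)
    fix s :: real
    show "ennreal (\<bar>s\<bar> * f s) * indicator {0..} s = (\<integral>\<^sup>+x. ennreal (f s) * indicator {0..s} x \<partial>lborel)"
    proof (cases "0 \<le> s")
      case True
      then show ?thesis by (simp add: nn_integral_cmult nonneg ennreal_mult mult.commute[of "ennreal s"])
    qed simp
  qed
  also have "\<dots> = ennreal (f 0) * (\<integral>\<^sup>+s. (\<integral>\<^sup>+x. ennreal (f s) * indicator {(x, s). 0 \<le> x \<and> x \<le> s} (x, s) \<partial>lborel) \<partial>lborel)"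
    by (auto simp: indicator_def intro!: arg_cong2[where f = "(*)"] nn_integral_cong)
  also have "\<dots> = ennreal (f 0) * (\<integral>\<^sup>+x. (\<integral>\<^sup>+s. ennreal (f s) * indicator {(x, s). 0 \<le> x \<and> x \<le> s} (x, s) \<partial>lborel) \<partial>lborel)"
    by (subst lborel_pair.Fubini') auto
  also have "\<dots> = (\<integral>\<^sup>+x. ennreal (f 0) * (\<integral>\<^sup>+s. ennreal (f s) * indicator {x..} s \<partial>lborel) * indicator {0..} x \<partial>lborel)"
    by (subst nn_integral_cmult[symmetric])
       (auto simp: indicator_def intro!: nn_integral_cong)
  also have "\<dots> \<le> (\<integral>\<^sup>+x. ennreal (1/2) * (ennreal (f x) * indicator {0..} x) \<partial>lborel)"
    using tail_le by (intro nn_integral_mono) (auto simp: indicator_def mult.commute)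
  also have "\<dots> = ennreal (1/2) * ennreal (1/2)"
    by (simp add: nn_integral_cmult nn_integral_half)
  finally have *: "ennreal (f 0) * ?I \<le> ennreal (1/2) * ennreal (1/2)" .
  have "ennreal (1/2) * ennreal (1/2) = ennreal (1/4)"
    by (subst ennreal_mult[symmetric]) simp_all
  with * have **: "ennreal (f 0) * ?I \<le> ennreal (1/4)"
    by (simp only:)
  then have "?I \<le> ennreal (1 / (4 * f 0))"
  proof (cases ?I)
    case (real r)
    have "f 0 * r \<le> 1/4"
      using ** unfolding real(2) ennreal_mult[OF nonneg real(1), symmetric]
      by (subst (asm) ennreal_le_iff) simp_all
    then have "r \<le> 1 / (4 * f 0)" using max_pos by (simp add: field_simps)
    then show ?thesis unfolding real(2) by (rule ennreal_leI)
  next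
    case top
    then show ?thesis
      using ** max_pos by (simp add: ennreal_mult_top top_unique)
  qed
  then have "2 * ?I \<le> 2 * ennreal (1 / (4 * f 0))"
    by (rule mult_left_mono) simp
  also have "\<dots> = ennreal (1 / (2 * f 0))"
    using max_pos by (simp flip: ennreal_mult ennreal_numeral)
  finally show ?thesis
    using nn_integral_even[of "\<lambda>x. ennreal (\<bar>x\<bar> * f x)"] by (simp add: even)
qed

lemma integrable: "integrable lborel f"
  by (rule integrableI_nonneg) (auto simp: nonneg nn_integral_eq_1)

lemma integral_eq_1: "(\<integral>x. f x \<partial>lborel) = 1"
  by (subst integral_eq_nn_integral) (auto simp: nonneg nn_integral_eq_1)

lemma integrable_abs_moment: "integrable lborel (\<lambda>x. \<bar>x\<bar> * f x)"
  by (rule integrableI_nonneg) (auto simp: nonneg le_less_trans[OF abs_moment_nn])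

lemma abs_moment_le: "(\<integral>x. \<bar>x\<bar> * f x \<partial>lborel) \<le> 1 / (2 * f 0)"
proof -
  have "ennreal (\<integral>x. \<bar>x\<bar> * f x \<partial>lborel) = (\<integral>\<^sup>+x. ennreal (\<bar>x\<bar> * f x) \<partial>lborel)"
    by (rule nn_integral_eq_integral[symmetric]) (auto simp: nonneg integrable_abs_moment)
  then have "ennreal (\<integral>x. \<bar>x\<bar> * f x \<partial>lborel) \<le> ennreal (1 / (2 * f 0))"
    using abs_moment_nn by simp
  then show ?thesis
    using max_pos by (subst (asm) ennreal_le_iff) auto
qed

text \<open>On \<open>{0..x}\<close> the density is at most \<open>f 0\<close>, so the tail beyond
  \<open>x\<close> keeps mass at least \<open>1/2 - f 0 * x\<close>; \<open>tail_le\<close> converts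
  this into a lower bound for \<open>f x\<close>.\<close>

lemma lower_bound: "f 0 * (1 - 2 * f 0 * \<bar>x\<bar>) \<le> f x"
proof -
  have *: "f 0 * (1 - 2 * f 0 * x) \<le> f x" if "0 \<le> x" for x
  proof -
    let ?T = "\<integral>\<^sup>+s. ennreal (f s) * indicator {x..} s \<partial>lborel"
    have "ennreal (1/2) = (\<integral>\<^sup>+s. ennreal (f s) * indicator {0..} s \<partial>lborel)"
      by (simp only: nn_integral_half)
    also have "\<dots> \<le> (\<integral>\<^sup>+s. ennreal (f s) * indicator {x..} s + ennreal (f 0) * indicator {0..x} s \<partial>lborel)"
      using le_max by (intro nn_integral_mono) (auto simp: indicator_def nonneg intro!: ennreal_leI)
    also have "\<dots> = ?T + ennreal (f 0 * x)"
      using that by (simp add: nn_integral_add nn_integral_cmult nonneg flip: ennreal_mult)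
    finally have 1: "ennreal (1/2) \<le> ?T + ennreal (f 0 * x)" .
    have 2: "ennreal (f 0) * ?T \<le> ennreal (f x) * ennreal (1/2)"
      by (rule tail_le[OF that])
    obtain T where T: "?T = ennreal T" "0 \<le> T"
      using 2 max_pos by (cases ?T) (auto simp: ennreal_mult_top ennreal_top_mult top_unique ennreal_mult_eq_top_iff)
    have "1/2 \<le> T + f 0 * x"
      using 1 that nonneg[of 0] T(2) unfolding T(1) ennreal_plus[OF T(2) mult_nonneg_nonneg[OF nonneg that], symmetric]
      by (subst (asm) ennreal_le_iff) auto
    then have "f 0 * (1/2) \<le> f 0 * (T + f 0 * x)"
      using max_pos by simp
    moreover have "f 0 * T \<le> f x * (1/2)"
      using 2 unfolding T(1) ennreal_mult[OF nonneg T(2), symmetric] ennreal_mult'[OF nonneg, symmetric]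
      by (subst (asm) ennreal_le_iff) (use nonneg[of x] in auto)
    ultimately show ?thesis by (simp add: algebra_simps)
  qed
  show ?thesis
    using *[of x] *[of "- x"] by (cases "0 \<le> x") (auto simp: even)
qed

lemma decay:
  assumes "0 < x"
  shows "f x \<le> 1 / (2 * x)"
proof -
  have "ennreal (f x * x) = (\<integral>\<^sup>+s. ennreal (f x) * indicator {0..x} s \<partial>lborel)"
    using assms by (simp add: nn_integral_cmult nonneg ennreal_mult)
  also have "\<dots> \<le> (\<integral>\<^sup>+s. ennreal (f s) * indicator {0..} s \<partial>lborel)"
    using antimono by (intro nn_integral_mono) (auto simp: indicator_def intro!: ennreal_leI)
  finally have "f x * x \<le> 1/2"
    unfolding nn_integral_half by (subst (asm) ennreal_le_iff) auto
  with assms show ?thesis by (simp add: field_simps)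
qed

text \<open>Once \<open>f\<close> has dropped by the factor \<open>exp 1\<close> at some point
  \<open>r\<close>, log-concavity along segments from 0 forces at least the same average rate beyond
  \<open>r\<close>. Up to \<open>r\<close> the bound is no smaller than the maximum.\<close>

lemma upper_bound: "f x \<le> f 0 * exp (1 - 2 * f 0 * \<bar>x\<bar> / exp 1)"
proof -
  \<comment> \<open>At this point \<open>decay\<close> gives
    \<open>f r \<le> 1 / (2 * r) = f 0 / exp 1\<close>.\<close>
  define r where "r = exp 1 / (2 * f 0)"
  have r: "0 < r" using max_pos by (simp add: r_def)
  have *: "f x \<le> f 0 * exp (1 - x / r)" if "0 \<le> x" for x
  proof (cases "x \<le> r \<or> f x = 0")
    case True
    then show ?thesis
    proof
      assume "x \<le> r"
      then have "1 \<le> exp (1 - x / r)" using r by simp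
      then have "f 0 * 1 \<le> f 0 * exp (1 - x / r)"
        using max_pos by (intro mult_left_mono) auto
      then show ?thesis using le_max[of x] by linarith
    qed (use max_pos in simp)
  next
    case False
    then have x: "r < x" "0 < f x" using nonneg[of x] by auto
    define t where "t = r / x"
    have t: "0 < t" "t < 1" "t * x = r" using x r by (auto simp: t_def)
    have "f 0 powr (1 - t) * f x powr t \<le> f r"
      using log_concave[of t 0 x] t by simp
    also have "f r \<le> f 0 * exp (-1)"
      using decay[OF r] max_pos by (simp add: r_def exp_minus field_simps)
    finally have "ln (f 0 powr (1 - t) * f x powr t) \<le> ln (f 0 * exp (-1))"
      using max_pos x by simp
    then have "t * (ln (f x) - ln (f 0)) \<le> - 1"
      using max_pos x by (simp add: ln_mult ln_powr algebra_simps)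
    then have "ln (f x) - ln (f 0) \<le> - 1 / t"
      using t by (simp add: field_simps)
    also have "- 1 / t = - x / r" by (simp add: t_def)
    finally have "ln (f x) \<le> ln (f 0 * exp (1 - x / r))"
      using max_pos by (simp add: ln_mult)
    then show ?thesis
      using max_pos x by simp
  qed
  show ?thesis
    using *[of x] *[of "- x"] by (cases "0 \<le> x") (auto simp: even r_def field_simps)
qed


section \<open>Entropy bounds by comparison with Laplace densities\<close>

definition laplace :: "real \<Rightarrow> real" where
  "laplace x = f 0 * exp (- (2 * f 0 * \<bar>x\<bar>))"

end

lemma nn_integral_laplace:
  assumes c: "0 < (c::real)"
  shows "(\<integral>\<^sup>+x. ennreal (c * exp (- (2 * c * \<bar>x\<bar>))) \<partial>lborel) = 1"
proof -
  let ?E = "exponential_density (2 * c)"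
  have 1: "(\<integral>\<^sup>+x. ennreal (?E x) \<partial>lborel) = 1"
  proof -
    interpret prob_space "density lborel ?E"
      by (rule prob_space_exponential_density) (use c in simp)
    show ?thesis using emeasure_space_1 by (simp add: emeasure_density)
  qed
  have 2: "(\<integral>\<^sup>+x. ennreal (?E (- x)) \<partial>lborel) = 1"
    using nn_integral_real_affine[of "\<lambda>x. ennreal (?E x)" "-1" 0] by (simp add: 1)
  have "(\<integral>\<^sup>+x. ennreal (c * exp (- (2 * c * \<bar>x\<bar>))) \<partial>lborel) =
    (\<integral>\<^sup>+x. ennreal (1/2) * (ennreal (?E x) + ennreal (?E (- x))) \<partial>lborel)"
  \<comment> \<open>Away from 0 the Laplace density is the half-sum of an exponential density and
    its reflection; at 0 both are positive and the half-sum is twice too large.\<close>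
  proof (rule nn_integral_cong_AE, rule AE_mp[OF AE_lborel_singleton[of 0]], intro AE_I2 impI)
    fix x :: real assume "x \<noteq> 0"
    then show "ennreal (c * exp (- (2 * c * \<bar>x\<bar>))) = ennreal (1/2) * (ennreal (?E x) + ennreal (?E (- x)))"
      using c by (auto simp: exponential_density_def mult_ac simp del: ennreal_half simp flip: ennreal_mult ennreal_plus)
  qed
  also have "\<dots> = ennreal (1/2) * ennreal 2"
  proof -
    have "(\<integral>\<^sup>+x. ennreal (1/2) * (ennreal (?E x) + ennreal (?E (- x))) \<partial>lborel)
      = ennreal (1/2) * (\<integral>\<^sup>+x. ennreal (?E x) + ennreal (?E (- x)) \<partial>lborel)"
      by (rule nn_integral_cmult) measurable
    also have "(\<integral>\<^sup>+x. ennreal (?E x) + ennreal (?E (- x)) \<partial>lborel)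
      = (\<integral>\<^sup>+x. ennreal (?E x) \<partial>lborel) + (\<integral>\<^sup>+x. ennreal (?E (- x)) \<partial>lborel)"
      by (rule nn_integral_add) measurable
    finally show ?thesis by (simp only: 1 2 one_add_one ennreal_numeral)
  qed
  also have "\<dots> = 1"
    by (subst ennreal_mult[symmetric]) simp_all
  finally show ?thesis .
qed

text \<open>The pointwise form of Gibbs' inequality, from \<open>ln u \<le> u - 1\<close> at
  \<open>u = b / a\<close>. It includes \<open>a = 0\<close>, so the first density may
  vanish.\<close>

lemma ln_ratio_le:
  assumes "0 \<le> (a::real)" "0 < b"
  shows "a * ln b - a * ln a \<le> b - a"
proof (cases "a = 0")
  case False
  with assms have "ln (b / a) \<le> b / a - 1"
    by (intro ln_le_minus_one) auto
  then have "a * ln (b / a) \<le> a * (b / a - 1)"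
    using assms by (intro mult_left_mono)
  with False assms show ?thesis
    by (simp add: ln_div algebra_simps)
qed (use assms in simp)

lemma gibbs_inequality:
  fixes f h :: "'a \<Rightarrow> real"
  assumes f: "integrable M f" "(\<integral>x. f x \<partial>M) = 1" "\<And>x. 0 \<le> f x"
    and h: "integrable M h" "(\<integral>x. h x \<partial>M) \<le> 1" "\<And>x. 0 < h x"
    and int: "integrable M (\<lambda>x. f x * ln (f x))" "integrable M (\<lambda>x. f x * ln (h x))"
  shows "- (\<integral>x. f x * ln (f x) \<partial>M) \<le> - (\<integral>x. f x * ln (h x) \<partial>M)"
proof -
  have "(\<integral>x. f x * ln (h x) - f x * ln (f x) \<partial>M) \<le> (\<integral>x. h x - f x \<partial>M)"
    using f h int by (intro integral_mono ln_ratio_le Bochner_Integration.integrable_diff) auto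
  then show ?thesis
    using f h int by simp
qed

context even_log_concave_density
begin

lemma laplace_pos: "0 < laplace x"
  using max_pos by (simp add: laplace_def)

lemma measurable_laplace[measurable]: "laplace \<in> borel_measurable borel"
  unfolding laplace_def by measurable

lemma ln_laplace: "ln (laplace x) = ln (f 0) - 2 * f 0 * \<bar>x\<bar>"
  using max_pos by (simp add: laplace_def ln_mult)

lemma integrable_laplace: "integrable lborel laplace"
  using nn_integral_laplace[OF max_pos] laplace_pos
  by (intro integrableI_nonneg) (simp_all add: less_imp_le flip: laplace_def)

text \<open>From above, \<open>ln (f x) \<le> ln (f 0)\<close>. From below,
  \<open>ln_ratio_le\<close> against \<open>laplace\<close> leaves only \<open>f\<close>, its first
  absolute moment and \<open>laplace\<close>, all integrable.\<close>

lemma integrable_entropy: "integrable lborel (\<lambda>x. f x * ln (f x))"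
proof (rule Bochner_Integration.integrable_bound)
  show "integrable lborel (\<lambda>x. \<bar>ln (f 0)\<bar> * f x + 2 * f 0 * (\<bar>x\<bar> * f x) + laplace x)"
    by (intro Bochner_Integration.integrable_add integrable_mult_right integrable
        integrable_abs_moment integrable_laplace)
  show "(\<lambda>x. f x * ln (f x)) \<in> borel_measurable lborel"
    by (simp add: measurable_f)
  show "AE x in lborel. norm (f x * ln (f x))
     \<le> norm (\<bar>ln (f 0)\<bar> * f x + 2 * f 0 * (\<bar>x\<bar> * f x) + laplace x)"
  proof (intro AE_I2)
    fix x
    have "f x * ln (f x) \<le> f x * \<bar>ln (f 0)\<bar>"
    proof (cases "f x = 0")
      case False
      then have "0 < f x" using nonneg[of x] by linarith
      then have "ln (f x) \<le> ln (f 0)" using le_max[of x] max_pos by simp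
      then show ?thesis by (intro mult_left_mono) (auto simp: nonneg)
    qed simp
    moreover have "f x * ln (laplace x) - f x * ln (f x) \<le> laplace x - f x"
      by (intro ln_ratio_le nonneg laplace_pos)
    moreover have "f x * ln (laplace x) = f x * ln (f 0) - 2 * f 0 * (\<bar>x\<bar> * f x)"
      by (simp add: ln_laplace algebra_simps)
    moreover have "- (f x * \<bar>ln (f 0)\<bar>) \<le> f x * ln (f 0)"
      using mult_left_mono[of "- \<bar>ln (f 0)\<bar>" "ln (f 0)" "f x"] nonneg[of x] by simp
    moreover have "0 \<le> 2 * f 0 * (\<bar>x\<bar> * f x)" "0 \<le> laplace x"
      using nonneg laplace_pos[of x] by auto
    moreover have "\<bar>u\<bar> \<le> A + B + l"
      if "u \<le> A" "v - u \<le> l - k" "v = w - B" "- A \<le> w" "0 \<le> B" "0 \<le> l" "0 \<le> k"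
      for u v w k l A B :: real
      using that by linarith
    ultimately have "\<bar>f x * ln (f x)\<bar> \<le> f x * \<bar>ln (f 0)\<bar> + 2 * f 0 * (\<bar>x\<bar> * f x) + laplace x"
      using nonneg[of x] by blast
    also have "\<dots> = \<bar>ln (f 0)\<bar> * f x + 2 * f 0 * (\<bar>x\<bar> * f x) + laplace x" by simp
    finally show "norm (f x * ln (f x)) \<le> norm (\<bar>ln (f 0)\<bar> * f x + 2 * f 0 * (\<bar>x\<bar> * f x) + laplace x)"
      unfolding real_norm_def by (rule order.trans[OF _ abs_ge_self])
  qed
qed

definition entropy :: real where
  "entropy = - (\<integral>x. f x * ln (f x) \<partial>lborel)"

lemma entropy_ge: "- ln (f 0) \<le> entropy"
proof -
  have "(\<integral>x. f x * ln (f x) \<partial>lborel) \<le> (\<integral>x. ln (f 0) * f x \<partial>lborel)"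
  proof (intro integral_mono integrable_entropy integrable_mult_right integrable)
    fix x
    show "f x * ln (f x) \<le> ln (f 0) * f x"
    proof (cases "f x = 0")
      case False
      then have "0 < f x" using nonneg[of x] by linarith
      then show ?thesis using le_max[of x] max_pos by (simp add: mult.commute)
    qed simp
  qed
  then show ?thesis by (simp add: entropy_def integral_eq_1)
qed

lemma entropy_le_gibbs:
  assumes "integrable lborel h" "(\<integral>x. h x \<partial>lborel) \<le> 1" "\<And>x. 0 < h x"
    and "integrable lborel (\<lambda>x. f x * ln (h x))"
  shows "entropy \<le> - (\<integral>x. f x * ln (h x) \<partial>lborel)"
  unfolding entropy_def
  by (intro gibbs_inequality integrable integral_eq_1 nonneg integrable_entropy assms)

text \<open>The parameter stays free because the best \<open>c\<close> depends on the first moment,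
  of which only upper bounds are at hand: \<open>c = f 0\<close> serves a single density, another
  choice serves the sum.\<close>

lemma entropy_le_laplace:
  assumes c: "0 < c"
  shows "entropy \<le> 2 * c * (\<integral>x. \<bar>x\<bar> * f x \<partial>lborel) - ln c"
proof -
  let ?h = "\<lambda>x. c * exp (- (2 * c * \<bar>x\<bar>))"
  have eq: "f x * ln (?h x) = ln c * f x - 2 * c * (\<bar>x\<bar> * f x)" for x
    using c by (simp add: ln_mult algebra_simps)
  have "entropy \<le> - (\<integral>x. f x * ln (?h x) \<partial>lborel)"
  proof (rule entropy_le_gibbs)
    show "integrable lborel ?h"
      using nn_integral_laplace[OF c] c by (intro integrableI_nonneg) auto
    show "(\<integral>x. ?h x \<partial>lborel) \<le> 1"
      using nn_integral_laplace[OF c] c by (subst integral_eq_nn_integral) auto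
    show "integrable lborel (\<lambda>x. f x * ln (?h x))"
      unfolding eq by (intro Bochner_Integration.integrable_diff integrable_mult_right integrable integrable_abs_moment)
  qed (use c in simp)
  also have "\<dots> = 2 * c * (\<integral>x. \<bar>x\<bar> * f x \<partial>lborel) - ln c"
    unfolding eq by (simp add: integrable integrable_abs_moment integral_eq_1)
  finally show ?thesis .
qed

lemma entropy_le: "entropy \<le> 1 - ln (f 0)"
proof -
  have "entropy \<le> 2 * f 0 * (\<integral>x. \<bar>x\<bar> * f x \<partial>lborel) - ln (f 0)"
    by (rule entropy_le_laplace[OF max_pos])
  also have "2 * f 0 * (\<integral>x. \<bar>x\<bar> * f x \<partial>lborel) \<le> 2 * f 0 * (1 / (2 * f 0))"
    using max_pos by (intro mult_left_mono abs_moment_le) auto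
  also have "\<dots> = 1" using max_pos by simp
  finally show ?thesis by simp
qed

end


section \<open>Entropy of a sum\<close>

text \<open>This is what is kept of the log-concave vector: even log-concave densities for the two
  projections and for their sum. \<open>X\<close> and \<open>Y\<close> may be dependent.\<close>

locale log_concave_sum = prob_space M + f: even_log_concave_density f + g: even_log_concave_density g +
    k: even_log_concave_density k
  for M :: "'a measure" and X Y :: "'a \<Rightarrow> real" and f g k +
  assumes X: "distributed M lborel X (\<lambda>x. ennreal (f x))"
    and Y: "distributed M lborel Y (\<lambda>x. ennreal (g x))"
    and sum: "distributed M lborel (\<lambda>\<omega>. X \<omega> + Y \<omega>) (\<lambda>x. ennreal (k x))"
begin

lemma integrable_abs: "integrable M (\<lambda>\<omega>. \<bar>X \<omega>\<bar>)" "integrable M (\<lambda>\<omega>. \<bar>Y \<omega>\<bar>)"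
  using distributed_integrable[OF X, of abs] distributed_integrable[OF Y, of abs]
    f.integrable_abs_moment g.integrable_abs_moment
  by (simp_all add: f.nonneg g.nonneg mult.commute)

lemma expectation_abs_le:
  "expectation (\<lambda>\<omega>. \<bar>X \<omega>\<bar>) \<le> 1 / (2 * f 0)" "expectation (\<lambda>\<omega>. \<bar>Y \<omega>\<bar>) \<le> 1 / (2 * g 0)"
  using distributed_integral[OF X, of abs] distributed_integral[OF Y, of abs]
    f.abs_moment_le g.abs_moment_le
  by (simp_all add: f.nonneg g.nonneg mult.commute)

lemma exp_entropy_sum_le: "exp k.entropy \<le> exp 1 * (1 / f 0 + 1 / g 0)"
proof -
  \<comment> \<open>Chosen so that \<open>1 / (2 * c)\<close> is the sum of the two first-moment
    bounds; the moment term of \<open>entropy_le_laplace\<close> is then at most 1.\<close>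
  define c where "c = 1 / (1 / f 0 + 1 / g 0)"
  have pos: "0 < 1 / f 0 + 1 / g 0"
    using f.max_pos g.max_pos by (intro add_pos_pos) auto
  then have c: "0 < c" by (simp add: c_def)
  have "(\<integral>x. \<bar>x\<bar> * k x \<partial>lborel) = expectation (\<lambda>\<omega>. \<bar>X \<omega> + Y \<omega>\<bar>)"
    using distributed_integral[OF sum, of abs] by (simp add: k.nonneg mult.commute)
  also have "\<dots> \<le> expectation (\<lambda>\<omega>. \<bar>X \<omega>\<bar> + \<bar>Y \<omega>\<bar>)"
  proof (rule integral_mono)
    show "integrable M (\<lambda>\<omega>. \<bar>X \<omega> + Y \<omega>\<bar>)"
      using distributed_integrable[OF sum, of abs] k.integrable_abs_moment
      by (simp add: k.nonneg mult.commute)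
  qed (auto intro: integrable_abs)
  also have "\<dots> \<le> 1 / (2 * f 0) + 1 / (2 * g 0)"
    using expectation_abs_le integrable_abs by simp
  also have "\<dots> = 1 / (2 * c)"
    using f.max_pos g.max_pos by (simp add: c_def field_simps)
  finally have "2 * c * (\<integral>x. \<bar>x\<bar> * k x \<partial>lborel) \<le> 2 * c * (1 / (2 * c))"
    using c by (intro mult_left_mono) auto
  then have "k.entropy \<le> 1 - ln c"
    using k.entropy_le_laplace[OF c] c by simp
  then have "exp k.entropy \<le> exp (1 - ln c)" by simp
  also have "\<dots> = exp 1 * (1 / f 0 + 1 / g 0)"
    using c by (simp add: exp_diff c_def)
  finally show ?thesis .
qed

text \<open>
  Gibbs' inequality for \<open>X + Y\<close> with the mixture of a slightly dilated copy of \<open>f\<close>, which is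
  comparable to \<open>f (X)\<close> at \<open>X + Y\<close> as long as \<open>\<bar>Y\<bar> \<le> \<delta> / (4 * f 0)\<close>, and a Laplace density with a
  heavier tail than \<open>f\<close>, which takes care of the rare large values of \<open>Y\<close>.
\<close>
lemma entropy_perturbation:
  assumes \<epsilon>: "0 < \<epsilon>" "\<epsilon> < 1" and \<delta>: "0 < \<delta>"
  shows "k.entropy \<le> f.entropy - ln (1 - \<epsilon>) + ln (1 + \<delta>) + \<delta>
    + (2 - ln \<epsilon>) * (2 * f 0 / (\<delta> * g 0)) + f 0 / (exp 1 * g 0)"
proof -
  \<comment> \<open>The rate \<open>2 * c\<close> is the one in \<open>upper_bound\<close>, so the
    terms in \<open>|x|\<close> cancel when \<open>q (x + y)\<close> is compared with
    \<open>f x\<close>.\<close>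
  define c where "c = f 0 / exp 1"
  define p where "p z = f (z / (1 + \<delta>)) / (1 + \<delta>)" for z
  define q where "q z = c * exp (- (2 * c * \<bar>z\<bar>))" for z
  define h where "h z = (1 - \<epsilon>) * p z + \<epsilon> * q z" for z
  define C where "C = ln (1 + \<delta>) + \<delta> - ln (1 - \<epsilon>)"
  \<comment> \<open>The first summand is the loss \<open>2 - ln \<epsilon>\<close> divided by the
    cutoff \<open>\<delta> / (4 * f 0)\<close>, as in Markov's inequality; \<open>2 * c\<close> is
    the Lipschitz constant of the exponent of \<open>q\<close>.\<close>
  define D where "D = (2 - ln \<epsilon>) * (4 * f 0 / \<delta>) + 2 * c"
  have c: "0 < c" using f.max_pos by (simp add: c_def)
  have p_nonneg: "0 \<le> p z" and q_pos: "0 < q z" for z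
    using f.nonneg \<delta> c by (auto simp: p_def q_def)
  have h_pos: "0 < h z" for z
    using p_nonneg[of z] q_pos[of z] \<epsilon> by (auto simp: h_def intro!: add_nonneg_pos)
  have [measurable]: "p \<in> borel_measurable borel" "q \<in> borel_measurable borel"
    unfolding p_def q_def by measurable
  then have [measurable]: "h \<in> borel_measurable borel"
    unfolding h_def by measurable
  have nn_p: "(\<integral>\<^sup>+z. ennreal (p z) \<partial>lborel) = 1"
  proof -
    have "(\<integral>\<^sup>+z. ennreal (p z) \<partial>lborel) = ennreal (1 + \<delta>) * (\<integral>\<^sup>+x. ennreal (p ((1 + \<delta>) * x)) \<partial>lborel)"
      using nn_integral_real_affine[of "\<lambda>z. ennreal (p z)" "1 + \<delta>" 0] \<delta> by simp
    also have "\<dots> = (\<integral>\<^sup>+x. ennreal (1 + \<delta>) * ennreal (p ((1 + \<delta>) * x)) \<partial>lborel)"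
      by (rule nn_integral_cmult[symmetric]) measurable
    also have "\<dots> = (\<integral>\<^sup>+x. ennreal (f x) \<partial>lborel)"
      using \<delta> f.nonneg by (intro nn_integral_cong) (simp add: p_def del: ennreal_plus flip: ennreal_mult)
    finally show ?thesis using f.nn_integral_eq_1 by simp
  qed
  have int_p: "integrable lborel p" "(\<integral>z. p z \<partial>lborel) = 1"
    using nn_p p_nonneg by (auto simp: integral_eq_nn_integral intro!: integrableI_nonneg)
  have nn_q: "(\<integral>\<^sup>+z. ennreal (q z) \<partial>lborel) = 1"
    unfolding q_def by (rule nn_integral_laplace[OF c])
  have int_q: "integrable lborel q" "(\<integral>z. q z \<partial>lborel) = 1"
    using nn_q less_imp_le[OF q_pos] by (auto simp: integral_eq_nn_integral intro!: integrableI_nonneg)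
  have int_h: "integrable lborel h" "(\<integral>z. h z \<partial>lborel) \<le> 1"
    unfolding h_def using int_p int_q by auto
  \<comment> \<open>Together with the pointwise estimate below, this upper bound makes
    \<open>ln (h (X + Y))\<close> integrable.\<close>
  have h_le: "h z \<le> f 0" for z
  proof -
    have "f (z / (1 + \<delta>)) * 1 \<le> f 0 * (1 + \<delta>)"
      using f.le_max f.max_pos \<delta> by (intro mult_mono) auto
    then have 1: "p z \<le> f 0" using \<delta> by (simp add: p_def field_simps)
    have "q z \<le> c * 1"
      unfolding q_def using c by (intro mult_left_mono) auto
    also have "c * 1 \<le> f 0"
      using f.max_pos by (simp add: c_def field_simps)
    finally have "q z \<le> f 0" .
    then show ?thesis
      unfolding h_def using convex_bound_le[OF 1, of "q z" "1 - \<epsilon>" \<epsilon>] \<epsilon> by simp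
  qed
  have pointwise: "- ln (h (x + y)) \<le> - ln (f x) + C + D * \<bar>y\<bar>" if fx: "0 < f x" for x y
  proof (cases "\<bar>y\<bar> * (4 * f 0 / \<delta>) \<le> 1")
    case True
    \<comment> \<open>The weight for which
      \<open>(x + y) / (1 + \<delta>) = (1 - t) * x + t * (y / \<delta>)\<close>. By the cutoff
      \<open>|y / \<delta>| \<le> 1 / (4 * f 0)\<close>, where \<open>lower_bound\<close> keeps
      \<open>f\<close> above \<open>f 0 / 2\<close>.\<close>
    define t where "t = \<delta> / (1 + \<delta>)"
    have t: "0 < t" "t < 1" "1 - t = 1 / (1 + \<delta>)" "t \<le> \<delta>"
      using \<delta> by (auto simp: t_def field_simps)
    have "f 0 * (1/2) \<le> f 0 * (1 - 2 * f 0 * \<bar>y / \<delta>\<bar>)"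
      using True \<delta> f.max_pos by (intro mult_left_mono) (auto simp: field_simps)
    also have "\<dots> \<le> f (y / \<delta>)" by (rule f.lower_bound)
    finally have fy: "f 0 / 2 \<le> f (y / \<delta>)" by simp
    have fy_pos: "0 < f (y / \<delta>)" using fy f.max_pos by linarith
    have arg: "(1 - t) * x + t * (y / \<delta>) = (x + y) / (1 + \<delta>)"
      using \<delta> by (simp add: t(3)) (simp add: t_def add_divide_distrib)
    have *: "f x powr (1 - t) * f (y / \<delta>) powr t \<le> f ((x + y) / (1 + \<delta>))"
      using f.log_concave[of t x "y / \<delta>"] t unfolding arg by simp
    have pos: "0 < f ((x + y) / (1 + \<delta>))"
      using * fx fy_pos by (smt (verit) mult_pos_pos powr_gt_zero)
    have "(1 - t) * ln (f x) + t * ln (f (y / \<delta>)) = ln (f x powr (1 - t) * f (y / \<delta>) powr t)"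
      using fx fy_pos by (simp add: ln_mult ln_powr)
    also have "\<dots> \<le> ln (f ((x + y) / (1 + \<delta>)))"
      using * fx fy_pos pos by (subst ln_le_cancel_iff) auto
    finally have 1: "(1 - t) * ln (f x) + t * ln (f (y / \<delta>)) \<le> ln (f ((x + y) / (1 + \<delta>)))" .
    \<comment> \<open>Log-concavity returns only the fraction \<open>1 - t\<close> of
      \<open>ln (f x)\<close>. Having \<open>t * ln (f (y / \<delta>))\<close> in place of the rest
      costs at most \<open>t * ln 2\<close>, because \<open>f x \<le> f 0\<close> and
      \<open>f (y / \<delta>) \<ge> f 0 / 2\<close>; this is rounded up to
      \<open>\<delta>\<close>.\<close>
    have "ln (f x) - 1 \<le> ln (f 0) - ln 2"
      using f.le_max[of x] fx f.max_pos ln_2_less_1 by (smt (verit) ln_le_cancel_iff)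
    also have "\<dots> = ln (f 0 / 2)"
      using f.max_pos by (simp add: ln_div)
    also have "\<dots> \<le> ln (f (y / \<delta>))"
      using fy fy_pos f.max_pos by (subst ln_le_cancel_iff) auto
    finally have "t * (ln (f x) - 1) \<le> t * ln (f (y / \<delta>))"
      using t by (intro mult_left_mono) auto
    then have 2: "ln (f x) - \<delta> \<le> ln (f ((x + y) / (1 + \<delta>)))"
      using 1 t(4) by (simp add: algebra_simps)
    have "(1 - \<epsilon>) * p (x + y) \<le> h (x + y)"
      using \<epsilon> q_pos[of "x + y"] by (simp add: h_def)
    then have "ln ((1 - \<epsilon>) * p (x + y)) \<le> ln (h (x + y))"
      using \<epsilon> pos \<delta> h_pos by (subst ln_le_cancel_iff) (auto simp: p_def)
    also have "ln ((1 - \<epsilon>) * p (x + y)) = ln (1 - \<epsilon>) + ln (f ((x + y) / (1 + \<delta>))) - ln (1 + \<delta>)"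
      using \<epsilon> pos \<delta> by (simp add: p_def ln_mult ln_div)
    finally have "- ln (h (x + y)) \<le> - ln (f x) + C"
      using 2 by (simp add: C_def)
    moreover have "0 \<le> D * \<bar>y\<bar>"
    proof -
      have "ln \<epsilon> \<le> 0" using \<epsilon> by simp
      then show ?thesis using c f.max_pos \<delta> by (auto simp: D_def)
    qed
    ultimately show ?thesis by linarith
  next
    case False
    have le: "0 \<le> 2 - ln \<epsilon>" using \<epsilon> ln_le_zero_iff[of \<epsilon>] by linarith
    have "\<epsilon> * q (x + y) \<le> h (x + y)"
      using \<epsilon> p_nonneg[of "x + y"] by (simp add: h_def)
    then have "ln (\<epsilon> * q (x + y)) \<le> ln (h (x + y))"
      using \<epsilon> q_pos[of "x + y"] h_pos[of "x + y"] by (subst ln_le_cancel_iff) auto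
    also have "ln (\<epsilon> * q (x + y)) = ln \<epsilon> + ln (f 0) - 1 - 2 * c * \<bar>x + y\<bar>"
      using \<epsilon> c f.max_pos by (simp add: q_def ln_mult) (simp add: c_def ln_div)
    finally have 1: "ln \<epsilon> + ln (f 0) - 1 - 2 * c * \<bar>x + y\<bar> \<le> ln (h (x + y))" .
    have 2: "2 * c * \<bar>x + y\<bar> \<le> 2 * c * \<bar>x\<bar> + 2 * c * \<bar>y\<bar>"
      using c mult_left_mono[OF abs_triangle_ineq[of x y], of "2 * c"] by (simp add: algebra_simps)
    \<comment> \<open>Origin of the 2 in \<open>2 - ln \<epsilon>\<close>: one unit is
      \<open>ln (f 0) - ln c\<close>, the other is the factor \<open>exp 1\<close> in
      \<open>upper_bound\<close>.\<close>
    have "ln (f x) \<le> ln (f 0 * exp (1 - 2 * f 0 * \<bar>x\<bar> / exp 1))"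
      using f.upper_bound[of x] fx f.max_pos by (subst ln_le_cancel_iff) auto
    also have "\<dots> = ln (f 0) + 1 - 2 * c * \<bar>x\<bar>"
      using f.max_pos by (simp add: ln_mult c_def)
    finally have 3: "ln (f x) \<le> ln (f 0) + 1 - 2 * c * \<bar>x\<bar>" .
    \<comment> \<open>Beyond the cutoff the constant loss is dominated by one linear in
      \<open>|y|\<close>, whose expectation is controlled: Markov's inequality in pointwise
      form.\<close>
    have 4: "2 - ln \<epsilon> \<le> (2 - ln \<epsilon>) * (\<bar>y\<bar> * (4 * f 0 / \<delta>))"
    proof -
      have "1 \<le> \<bar>y\<bar> * (4 * f 0 / \<delta>)" using False by simp
      from mult_left_mono[OF this le] show ?thesis by (simp only: mult_1_right)
    qed
    have 5: "0 \<le> C"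
    proof -
      have "ln (1 - \<epsilon>) \<le> 0" "0 \<le> ln (1 + \<delta>)" using \<epsilon> \<delta> by auto
      then show ?thesis using \<delta> unfolding C_def by linarith
    qed
    have 6: "D * \<bar>y\<bar> = (2 - ln \<epsilon>) * (\<bar>y\<bar> * (4 * f 0 / \<delta>)) + 2 * c * \<bar>y\<bar>"
      by (simp add: D_def algebra_simps)
    show ?thesis using 1 2 3 4 5 6 by linarith
  qed
  have fpos: "AE \<omega> in M. 0 < f (X \<omega>)"
    by (subst distributed_AE2[OF X]) auto
  have int_lnf: "integrable M (\<lambda>\<omega>. ln (f (X \<omega>)))" "expectation (\<lambda>\<omega>. ln (f (X \<omega>))) = - f.entropy"
    using distributed_integrable[OF X, of "\<lambda>x. ln (f x)"] distributed_integral[OF X, of "\<lambda>x. ln (f x)"]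
      f.integrable_entropy by (simp_all add: f.nonneg f.entropy_def)
  have XYm[measurable]: "X \<in> borel_measurable M" "Y \<in> borel_measurable M"
    using distributed_measurable[OF X] distributed_measurable[OF Y] by simp_all
  have int_lnh: "integrable M (\<lambda>\<omega>. ln (h (X \<omega> + Y \<omega>)))"
  proof (rule Bochner_Integration.integrable_bound)
    show "integrable M (\<lambda>\<omega>. \<bar>ln (f 0)\<bar> + (\<bar>ln (f (X \<omega>))\<bar> + \<bar>C\<bar> + \<bar>D\<bar> * \<bar>Y \<omega>\<bar>))"
      using int_lnf integrable_abs by auto
    show "(\<lambda>\<omega>. ln (h (X \<omega> + Y \<omega>))) \<in> borel_measurable M"
      by measurable
    show "AE \<omega> in M. norm (ln (h (X \<omega> + Y \<omega>))) \<le> norm (\<bar>ln (f 0)\<bar> + (\<bar>ln (f (X \<omega>))\<bar> + \<bar>C\<bar> + \<bar>D\<bar> * \<bar>Y \<omega>\<bar>))"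
      using fpos
    proof eventually_elim
      case (elim \<omega>)
      have 1: "ln (h (X \<omega> + Y \<omega>)) \<le> ln (f 0)"
        using h_le h_pos f.max_pos by simp
      have 2: "D * \<bar>Y \<omega>\<bar> \<le> \<bar>D\<bar> * \<bar>Y \<omega>\<bar>" "0 \<le> \<bar>D\<bar> * \<bar>Y \<omega>\<bar>"
        by (auto intro: mult_right_mono)
      have "\<bar>u\<bar> \<le> \<bar>m\<bar> + (\<bar>v\<bar> + \<bar>c\<bar> + w)" if "u \<le> m" "- u \<le> - v + c + d" "d \<le> w" "0 \<le> w"
        for u v c d w m :: real
        using that by linarith
      from this[OF 1 pointwise[OF elim, of "Y \<omega>"] 2]
      show ?case unfolding real_norm_def by (rule order_trans[OF _ abs_ge_self])
    qed
  qed
  have "k.entropy \<le> - (\<integral>x. k x * ln (h x) \<partial>lborel)"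
    using distributed_integrable[OF sum, of "\<lambda>x. ln (h x)"] int_lnh
    by (intro k.entropy_le_gibbs int_h h_pos) (simp add: k.nonneg)
  also have "\<dots> = expectation (\<lambda>\<omega>. - ln (h (X \<omega> + Y \<omega>)))"
    using distributed_integral[OF sum, of "\<lambda>x. ln (h x)"] by (simp add: k.nonneg)
  also have "\<dots> \<le> expectation (\<lambda>\<omega>. - ln (f (X \<omega>)) + C + D * \<bar>Y \<omega>\<bar>)"
    using fpos pointwise int_lnh int_lnf integrable_abs
    by (intro integral_mono_AE) (auto elim!: eventually_mono)
  also have "\<dots> = f.entropy + C + D * expectation (\<lambda>\<omega>. \<bar>Y \<omega>\<bar>)"
    using int_lnf integrable_abs prob_space by simp
  also have "D * expectation (\<lambda>\<omega>. \<bar>Y \<omega>\<bar>) \<le> D * (1 / (2 * g 0))"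
  proof -
    have "ln \<epsilon> \<le> 0" using \<epsilon> by simp
    then show ?thesis
      using c f.max_pos \<delta> by (intro mult_left_mono expectation_abs_le) (auto simp: D_def)
  qed
  also have "D * (1 / (2 * g 0)) = (2 - ln \<epsilon>) * (2 * f 0 / (\<delta> * g 0)) + f 0 / (exp 1 * g 0)"
    using g.max_pos \<delta> by (simp add: D_def c_def field_simps)
  finally show ?thesis by (simp add: C_def)
qed

lemma exp_fifth_entropy_le:
  assumes le: "g.entropy \<le> f.entropy"
  shows "exp (k.entropy / 5) \<le> exp (f.entropy / 5) + exp (g.entropy / 5)"
proof -
  define a where "a = exp f.entropy"
  define s where "s = exp ((g.entropy - f.entropy) / 5)"
  have s: "0 < s" "s \<le> 1" using le by (auto simp: s_def)
  have a: "0 < a" by (simp add: a_def)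
  have b: "exp g.entropy = a * s ^ 5"
  proof -
    have "exp g.entropy = exp (f.entropy + of_nat 5 * ((g.entropy - f.entropy) / 5))"
      by (simp add: field_simps)
    then show ?thesis unfolding exp_add exp_of_nat_mult a_def s_def .
  qed
  have F: "1 / f 0 \<le> a" "f 0 \<le> exp 1 / a"
  proof -
    have "exp (- ln (f 0)) \<le> exp f.entropy" using f.entropy_ge by simp
    then show "1 / f 0 \<le> a" using f.max_pos by (simp add: a_def exp_minus inverse_eq_divide)
    have "exp f.entropy \<le> exp (1 - ln (f 0))" using f.entropy_le by simp
    then show "f 0 \<le> exp 1 / a" using f.max_pos a by (simp add: a_def exp_diff field_simps)
  qed
  have G: "1 / g 0 \<le> a * s ^ 5"
  proof -
    have "exp (- ln (g 0)) \<le> exp g.entropy" using g.entropy_ge by simp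
    then show ?thesis using g.max_pos by (simp add: b exp_minus inverse_eq_divide)
  qed
  have "k.entropy \<le> f.entropy + 5 * ln (1 + s)"
  proof (cases "1 / 4 \<le> s")
    case True
    \<comment> \<open>In the binomial expansion of \<open>(1 + s) ^ 5\<close> the terms of degree 1
      to 3 contribute at least \<open>5/4 + 10/16 + 10/64 > 2\<close>, and \<open>5 * s ^ 4\<close>
      pays for the remaining \<open>2 * s ^ 5\<close>.\<close>
    have "(1/4)^2 \<le> s^2" "(1/4)^3 \<le> s^3"
      using True by (auto intro!: power_mono)
    then have "1/16 \<le> s^2" "1/64 \<le> s^3" by (simp_all add: power_divide)
    moreover have "s ^ 5 \<le> s ^ 4" using s by (intro power_decreasing) auto
    moreover have "0 \<le> s ^ 4" by simp
    ultimately have "3 * (1 + s ^ 5) \<le> 1 + 5 * s + 10 * s ^ 2 + 10 * s ^ 3 + 5 * s ^ 4 + s ^ 5"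
      using True unfolding distrib_left by linarith
    also have "\<dots> = (1 + s) ^ 5" by algebra
    finally have "3 * (1 + s ^ 5) \<le> (1 + s) ^ 5" .
    moreover have "exp 1 * (1 + s ^ 5) \<le> 3 * (1 + s ^ 5)"
      using s exp_le by (intro mult_right_mono) auto
    ultimately have "a * (exp 1 * (1 + s ^ 5)) \<le> a * (1 + s) ^ 5"
      using a by (intro mult_left_mono) auto
    moreover have "exp k.entropy \<le> exp 1 * (a + a * s ^ 5)"
      using F(1) G by (intro order.trans[OF exp_entropy_sum_le] mult_left_mono) auto
    ultimately have "exp k.entropy \<le> a * (1 + s) ^ 5"
      by (simp add: algebra_simps)
    also have "\<dots> = exp (f.entropy + 5 * ln (1 + s))"
      using s exp_of_nat_mult[of 5 "ln (1 + s)"] by (simp add: exp_add a_def)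
    finally show ?thesis by simp
  next
    case False
    have FG: "f 0 / g 0 \<le> exp 1 * s ^ 5"
    proof -
      have "f 0 * (1 / g 0) \<le> (exp 1 / a) * (a * s ^ 5)"
        using F(2) G f.max_pos g.max_pos a by (intro mult_mono) auto
      then show ?thesis using a by simp
    qed
    \<comment> \<open>Crude, but it gives up only one power of \<open>s\<close>, and
      \<open>s ^ 5\<close> against the division by \<open>s ^ 2\<close> can spare it.\<close>
    have ln_s: "- ln s \<le> 1 / s - 1"
      using ln_le_minus_one[of "1 / s"] s by (simp add: ln_div)
    have s2: "s ^ 2 \<le> s / 4" and s3: "s ^ 3 \<le> s / 16" and s5: "s ^ 5 \<le> s / 256"
    proof -
      have "s * s ^ 1 \<le> s * (1/4) ^ 1" "s * s ^ 2 \<le> s * (1/4) ^ 2" "s * s ^ 4 \<le> s * (1/4) ^ 4"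
        using False s by (auto intro!: mult_left_mono power_mono simp del: power_one_right)
      then show "s ^ 2 \<le> s / 4" "s ^ 3 \<le> s / 16" "s ^ 5 \<le> s / 256"
        by (simp_all add: power_divide eval_nat_numeral)
    qed
    have "- ln (1 - s) \<le> 1 / (1 - s) - 1"
      using ln_le_minus_one[of "1 / (1 - s)"] False s by (simp add: ln_div)
    also have "\<dots> = s / (1 - s)" using False by (simp add: field_simps)
    also have "\<dots> \<le> s / (3/4)" using False s by (intro divide_left_mono) auto
    finally have 1: "- ln (1 - s) \<le> 4 / 3 * s" by simp
    have 2: "ln (1 + s ^ 2) \<le> s / 4"
      using ln_add_one_self_le_self[of "s ^ 2"] s2 by simp
    have 3: "(2 - ln s) * (2 * f 0 / (s ^ 2 * g 0)) \<le> 6 * (s ^ 2 + s ^ 3)"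
    proof -
      have "2 * f 0 / (s ^ 2 * g 0) = 2 / s ^ 2 * (f 0 / g 0)" by simp
      also have "\<dots> \<le> 2 / s ^ 2 * (exp 1 * s ^ 5)"
        using FG by (intro mult_left_mono) auto
      also have "\<dots> = 2 * exp 1 * s ^ 3"
        using s by (simp add: field_simps eval_nat_numeral)
      also have "\<dots> \<le> 6 * s ^ 3"
        using exp_le s by (intro mult_right_mono) auto
      finally have "2 * f 0 / (s ^ 2 * g 0) \<le> 6 * s ^ 3" .
      moreover have "2 - ln s \<le> 1 + 1 / s" using ln_s by simp
      moreover have "0 \<le> 1 + 1 / s" using s by simp
      ultimately have "(2 - ln s) * (2 * f 0 / (s ^ 2 * g 0)) \<le> (1 + 1 / s) * (6 * s ^ 3)"
        using f.max_pos g.max_pos by (intro mult_mono) auto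
      also have "\<dots> = 6 * (s ^ 2 + s ^ 3)"
        using s by (simp add: field_simps eval_nat_numeral)
      finally show ?thesis .
    qed
    have 4: "f 0 / (exp 1 * g 0) \<le> s ^ 5"
      using divide_right_mono[OF FG, of "exp 1"] by (simp add: mult.commute)
    have "s / (1 + s) \<le> ln (1 + s)"
      using ln_le_minus_one[of "1 / (1 + s)"] s by (simp add: ln_div field_simps)
    moreover have "s / (5/4) \<le> s / (1 + s)"
      using False s by (intro divide_left_mono) auto
    ultimately have "s / (5/4) \<le> ln (1 + s)" by (rule order_trans[rotated])
    then have 5: "4 / 5 * s \<le> ln (1 + s)" by simp
    have "k.entropy \<le> f.entropy - ln (1 - s) + ln (1 + s ^ 2) + s ^ 2
      + (2 - ln s) * (2 * f 0 / (s ^ 2 * g 0)) + f 0 / (exp 1 * g 0)"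
      using False s by (intro entropy_perturbation) auto
    \<comment> \<open>For \<open>s < 1/4\<close> the losses add up to at most
      \<open>4/3 + 1/4 + 1/4 + 15/8 + 1/256 < 4\<close> times \<open>s\<close>, where
      \<open>15/8 = 6 * (1/4 + 1/16)\<close>; fact 5 converts \<open>4 * s\<close> into
      \<open>5 * ln (1 + s)\<close>.\<close>
    then show ?thesis
      using 1 2 3[unfolded distrib_left] 4 5 s2 s3 s5 s(1) by linarith
  qed
  then have "exp (k.entropy / 5) \<le> exp (f.entropy / 5 + ln (1 + s))" by simp
  also have "\<dots> = exp (f.entropy / 5) + exp (g.entropy / 5)"
    using s(1) by (simp add: exp_add algebra_simps)
      (simp add: s_def flip: exp_add add_divide_distrib)
  finally show ?thesis .
qed

end

text \<open>Exchanging \<open>X\<close> and \<open>Y\<close> gives a second instance of the locale,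
  which removes the assumption on which entropy is larger.\<close>

lemma exp_fifth_entropy_sum_le:
  assumes "prob_space M" "even_log_concave_density f" "even_log_concave_density g"
    "even_log_concave_density k"
    and X: "distributed M lborel X (\<lambda>x. ennreal (f x))"
    and Y: "distributed M lborel Y (\<lambda>x. ennreal (g x))"
    and Z: "distributed M lborel (\<lambda>\<omega>. X \<omega> + Y \<omega>) (\<lambda>x. ennreal (k x))"
  shows "exp (1/5 * Ent M (\<lambda>\<omega>. X \<omega> + Y \<omega>)) \<le> exp (1/5 * Ent M X) + exp (1/5 * Ent M Y)"
proof -
  interpret prob_space M by fact
  interpret f: even_log_concave_density f by fact
  interpret g: even_log_concave_density g by fact
  interpret k: even_log_concave_density k by fact
  have Z': "distributed M lborel (\<lambda>\<omega>. Y \<omega> + X \<omega>) (\<lambda>x. ennreal (k x))"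
    using Z by (simp add: add.commute)
  have 1: "log_concave_sum M X Y f g k" and 2: "log_concave_sum M Y X g f k"
    by unfold_locales (use X Y Z Z' in auto)
  have "exp (k.entropy / 5) \<le> exp (f.entropy / 5) + exp (g.entropy / 5)"
    using log_concave_sum.exp_fifth_entropy_le[OF 1] log_concave_sum.exp_fifth_entropy_le[OF 2]
    by (cases "g.entropy \<le> f.entropy") auto
  then show ?thesis
    using Ent_distributed[OF assms(1) X f.nonneg] Ent_distributed[OF assms(1) Y g.nonneg]
      Ent_distributed[OF assms(1) Z k.nonneg]
    by (simp add: f.entropy_def g.entropy_def k.entropy_def)
qed


section \<open>Projections of log-concave vectors\<close>

lemma measurable_scalar_prod[measurable]:
  "scalar_prod n w \<in> borel_measurable (lborel_n n)"
  unfolding scalar_prod_def by (intro borel_measurable_sum borel_measurable_times) measurable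

text \<open>
  The coordinate \<open>k\<close> is exchanged for \<open>s = \<langle>w, x\<rangle>\<close>; the density of \<open>\<langle>w, X\<rangle>\<close> is then the marginal over
  the remaining coordinates.
\<close>
lemma scalar_prod_distributed:
  assumes M: "prob_space M" and X: "distributed M (lborel_n n) X p"
    and lc: "\<And>t x y. 0 < t \<Longrightarrow> t < 1 \<Longrightarrow> x \<in> extensional {..<n} \<Longrightarrow> y \<in> extensional {..<n} \<Longrightarrow>
      geo_mean_le t (p x) (p y) (p (\<lambda>i\<in>{..<n}. (1 - t) * x i + t * y i))"
    and w: "k < n" "w k \<noteq> 0"
  obtains F where "distributed M lborel (\<lambda>\<omega>. scalar_prod n w (X \<omega>)) F"
    and "\<And>t x y. 0 < t \<Longrightarrow> t < 1 \<Longrightarrow> geo_mean_le t (F x) (F y) (F ((1 - t) * x + t * y))"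
proof -
  interpret product_sigma_finite "\<lambda>_. lborel :: real measure" by standard
  define J where "J = {..<n} - {k}"
  have J: "finite J" "k \<notin> J" "insert k J = {..<n}" using w by (auto simp: J_def)
  let ?PJ = "\<Pi>\<^sub>M i\<in>J. (lborel :: real measure)"
  interpret PJ: sigma_finite_measure ?PJ by (rule sigma_finite[OF J(1)])
  interpret pair: pair_sigma_finite ?PJ "lborel :: real measure" ..
  have [measurable]: "p \<in> borel_measurable (lborel_n n)" and Xm[measurable]: "X \<in> measurable M (lborel_n n)"
    using distributed_borel_measurable[OF X] distributed_measurable[OF X] by auto
  define \<sigma> where "\<sigma> x = (\<Sum>j\<in>J. w j * x j)" for x
  have \<sigma>_meas[measurable]: "\<sigma> \<in> borel_measurable ?PJ"
    unfolding \<sigma>_def by (intro borel_measurable_sum borel_measurable_times) measurable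
  \<comment> \<open>The point of the hyperplane \<open>scalar_prod n w z = s\<close> whose
    coordinates other than \<open>k\<close> are those of \<open>x\<close>.\<close>
  define lift where "lift x s = x(k := (s - \<sigma> x) / w k)" for x and s :: real
  have lift_meas[measurable]: "(\<lambda>(x, s). lift x s) \<in> measurable (?PJ \<Otimes>\<^sub>M lborel) (lborel_n n)"
  proof -
    have "(\<lambda>z. (fst z, (snd z - \<sigma> (fst z)) / w k)) \<in> measurable (?PJ \<Otimes>\<^sub>M lborel) (?PJ \<Otimes>\<^sub>M lborel)"
      by measurable
    from measurable_compose[OF this measurable_add_dim[of k J "\<lambda>_. lborel"]]
    show ?thesis unfolding J(3) by (simp add: lift_def case_prod_beta')
  qed
  define q where "q x s = p (lift x s)" for x s
  have q_meas[measurable]: "(\<lambda>(x, s). q x s) \<in> borel_measurable (?PJ \<Otimes>\<^sub>M lborel)"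
    using measurable_compose[OF lift_meas, of p] by (simp add: q_def case_prod_beta')
  have q_slice_meas: "(\<lambda>x. q x s) \<in> borel_measurable ?PJ" for s
  proof -
    have "(\<lambda>x. (x, s)) \<in> measurable ?PJ (?PJ \<Otimes>\<^sub>M lborel)" by simp
    from measurable_compose[OF this q_meas] show ?thesis by simp
  qed
  have scalar_prod_upd: "scalar_prod n w (x(k := y)) = \<sigma> x + w k * y" for x y
  proof -
    have "scalar_prod n w (x(k := y)) = (\<Sum>j\<in>insert k J. w j * (x(k := y)) j)"
      by (simp add: scalar_prod_def J(3))
    also have "\<dots> = w k * y + (\<Sum>j\<in>J. w j * (x(k := y)) j)"
      using J by (subst sum.insert) auto
    also have "(\<Sum>j\<in>J. w j * (x(k := y)) j) = \<sigma> x"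
      unfolding \<sigma>_def using J(2) by (intro sum.cong) auto
    finally show ?thesis by (simp only: add.commute)
  qed
  \<comment> \<open>The Jacobian of solving for the coordinate \<open>k\<close> in terms of
    \<open>s\<close>.\<close>
  define c where "c = 1 / \<bar>w k\<bar>"
  have c: "0 < c" using w by (simp add: c_def)
  define F where "F s = ennreal c * (\<integral>\<^sup>+x. q x s \<partial>?PJ)" for s
  have inner_meas: "(\<lambda>s. \<integral>\<^sup>+x. q x s \<partial>?PJ) \<in> borel_measurable lborel"
  proof (rule PJ.borel_measurable_nn_integral)
    have "(\<lambda>z. (snd z, fst z)) \<in> measurable (lborel \<Otimes>\<^sub>M ?PJ) (?PJ \<Otimes>\<^sub>M lborel)" by measurable
    from measurable_compose[OF this q_meas]
    show "case_prod (\<lambda>s x. q x s) \<in> borel_measurable (lborel \<Otimes>\<^sub>M ?PJ)"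
      by (simp add: case_prod_beta')
  qed
  have F_meas[measurable]: "F \<in> borel_measurable borel"
    using inner_meas unfolding F_def by simp
  have "distributed M lborel (\<lambda>\<omega>. scalar_prod n w (X \<omega>)) F"
    unfolding distributed_def
  proof (intro conjI measure_eqI)
    fix B :: "real set" assume "B \<in> sets (distr M lborel (\<lambda>\<omega>. scalar_prod n w (X \<omega>)))"
    then have B[measurable]: "B \<in> sets borel" by simp
    have "emeasure (distr M lborel (\<lambda>\<omega>. scalar_prod n w (X \<omega>))) B
      = (\<integral>\<^sup>+y. indicator B y \<partial>distr M lborel (\<lambda>\<omega>. scalar_prod n w (X \<omega>)))"
      by (rule nn_integral_indicator[symmetric]) simp
    also have "\<dots> = (\<integral>\<^sup>+\<omega>. indicator B (scalar_prod n w (X \<omega>)) \<partial>M)"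
      by (rule nn_integral_distr) measurable
    also have "\<dots> = (\<integral>\<^sup>+x. p x * indicator B (scalar_prod n w x) \<partial>lborel_n n)"
      by (rule distributed_nn_integral[OF X, symmetric]) measurable
    also have "\<dots> = (\<integral>\<^sup>+x. p x * indicator B (scalar_prod n w x) \<partial>(\<Pi>\<^sub>M i\<in>insert k J. lborel))"
      by (simp only: J(3))
    also have "\<dots> = (\<integral>\<^sup>+x. \<integral>\<^sup>+y. p (x(k := y)) * indicator B (scalar_prod n w (x(k := y))) \<partial>lborel \<partial>?PJ)"
      using J by (intro product_nn_integral_insert) (simp_all add: J(3))
    also have "\<dots> = (\<integral>\<^sup>+x. \<integral>\<^sup>+s. ennreal c * (q x s * indicator B s) \<partial>lborel \<partial>?PJ)"
    proof (rule nn_integral_cong)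
      fix x assume x: "x \<in> space ?PJ"
      let ?u = "\<lambda>y. p (x(k := y)) * indicator B (\<sigma> x + w k * y)"
      have "(\<lambda>y. x(k := y)) \<in> measurable lborel (lborel_n n)"
        using measurable_Pair2[OF measurable_add_dim[of k J "\<lambda>_. lborel"], of x] x unfolding J(3) by simp
      from measurable_compose[OF this, of p borel]
      have [measurable]: "(\<lambda>y. p (x(k := y))) \<in> borel_measurable borel" by simp
      have "(\<integral>\<^sup>+y. ?u y \<partial>lborel) = ennreal \<bar>1 / w k\<bar> * (\<integral>\<^sup>+s. ?u (- \<sigma> x / w k + 1 / w k * s) \<partial>lborel)"
        using w by (intro nn_integral_real_affine) auto
      also have "\<dots> = ennreal c * (\<integral>\<^sup>+s. q x s * indicator B s \<partial>lborel)"
        using w by (intro arg_cong2[where f = "(*)"] nn_integral_cong)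
          (auto simp: c_def q_def lift_def diff_divide_distrib add.commute algebra_simps)
      also have "\<dots> = (\<integral>\<^sup>+s. ennreal c * (q x s * indicator B s) \<partial>lborel)"
      proof (rule nn_integral_cmult[symmetric])
        have [measurable]: "q x \<in> borel_measurable lborel"
          using measurable_Pair2[OF q_meas x] by simp
        show "(\<lambda>s. q x s * indicator B s) \<in> borel_measurable lborel" by measurable
      qed
      finally show "(\<integral>\<^sup>+y. p (x(k := y)) * indicator B (scalar_prod n w (x(k := y))) \<partial>lborel)
        = (\<integral>\<^sup>+s. ennreal c * (q x s * indicator B s) \<partial>lborel)"
        by (simp only: scalar_prod_upd)
    qed
    also have "\<dots> = (\<integral>\<^sup>+s. \<integral>\<^sup>+x. ennreal c * (q x s * indicator B s) \<partial>?PJ \<partial>lborel)"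
      by (rule pair.Fubini'[symmetric]) measurable
    also have "\<dots> = (\<integral>\<^sup>+s. F s * indicator B s \<partial>lborel)"
    proof (rule nn_integral_cong)
      fix s :: real
      show "(\<integral>\<^sup>+x. ennreal c * (q x s * indicator B s) \<partial>?PJ) = F s * indicator B s"
        using q_slice_meas by (simp add: F_def nn_integral_cmult nn_integral_multc mult.assoc)
    qed
    also have "\<dots> = emeasure (density lborel F) B"
      by (rule emeasure_density[symmetric]) auto
    finally show "emeasure (distr M lborel (\<lambda>\<omega>. scalar_prod n w (X \<omega>))) B = emeasure (density lborel F) B" .
  qed auto
  moreover have "geo_mean_le t (F a) (F b) (F ((1 - t) * a + t * b))" if t: "0 < t" "t < 1" for t a b
    unfolding F_def
  proof (intro geo_mean_le_cmult prekopa_leindler_PiM J t c q_slice_meas)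
    fix x y :: "nat \<Rightarrow> real" assume xy: "x \<in> extensional J" "y \<in> extensional J"
    let ?z = "\<lambda>i\<in>J. (1 - t) * x i + t * y i"
    \<comment> \<open>Since \<open>\<sigma>\<close> is linear, \<open>lift\<close> is affine in
      \<open>x\<close> and \<open>s\<close> jointly. So log-concavity of \<open>p\<close> supplies
      the hypothesis of Prekopa-Leindler over the coordinates \<open>J\<close>.\<close>
    have \<sigma>_z: "\<sigma> ?z = (1 - t) * \<sigma> x + t * \<sigma> y"
      by (simp add: \<sigma>_def sum_distrib_left sum.distrib sum_subtractf algebra_simps)
    have "lift ?z ((1 - t) * a + t * b) k = (1 - t) * lift x a k + t * lift y b k"
      using w unfolding lift_def fun_upd_same \<sigma>_z by (simp add: field_simps)
    then have eq: "lift ?z ((1 - t) * a + t * b) = (\<lambda>i\<in>{..<n}. (1 - t) * lift x a i + t * lift y b i)"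
      (is "?l = ?r")
    proof (intro ext)
      fix i
      consider "i = k" | "i \<in> J" | "i \<notin> insert k J" by blast
      then show "?l i = ?r i"
      proof cases
        case 1
        then show ?thesis using \<open>?l k = _\<close> w(1) by simp
      next
        case 2
        then have "i \<noteq> k" "i < n" using J(2,3) by auto
        then show ?thesis using 2 by (simp add: lift_def)
      next
        case 3
        then have "i \<noteq> k" "\<not> i < n" "i \<notin> J" using J(3) by auto
        then show ?thesis by (simp add: lift_def)
      qed
    qed
    have ext: "lift u s \<in> extensional {..<n}" if "u \<in> extensional J" for u s
      using that unfolding J(3)[symmetric] by (simp add: lift_def extensional_def)
    show "geo_mean_le t (q x a) (q y b) (q ?z ((1 - t) * a + t * b))"
      unfolding q_def eq by (intro lc t ext xy)
  qed
  ultimately show thesis by (rule that)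
qed

text \<open>An infinite value at \<open>x\<close> would spread, by geometric means, to the whole
  open interval between \<open>x\<close> and any other point where \<open>F\<close> is positive,
  making the integral infinite. Such a point exists, as a single point carries no Lebesgue
  measure.\<close>

lemma log_concave_density_finite:
  fixes F :: "real \<Rightarrow> ennreal"
  assumes [measurable]: "F \<in> borel_measurable borel" and F: "(\<integral>\<^sup>+x. F x \<partial>lborel) = 1"
    and lc: "\<And>t x y. 0 < t \<Longrightarrow> t < 1 \<Longrightarrow> geo_mean_le t (F x) (F y) (F ((1 - t) * x + t * y))"
  shows "F x < \<infinity>"
proof (rule ccontr)
  assume "\<not> F x < \<infinity>"
  then have x: "F x = \<infinity>" using less_top[of "F x"] by auto
  have "\<exists>y. y \<noteq> x \<and> F y \<noteq> 0"
  proof (rule ccontr)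
    assume "\<nexists>y. y \<noteq> x \<and> F y \<noteq> 0"
    then have "(\<integral>\<^sup>+x. F x \<partial>lborel) = integral\<^sup>N lborel (\<lambda>_ :: real. 0)"
      by (intro nn_integral_cong_AE AE_I2[THEN AE_mp[OF AE_lborel_singleton[of x]]]) auto
    then show False using F by simp
  qed
  then obtain y where y: "y \<noteq> x" "0 < F y" by (auto simp: zero_less_iff_neq_zero)
  obtain \<beta> where \<beta>: "0 < \<beta>" "ennreal \<beta> < F y"
  proof -
    obtain d where d: "0 < d" "d < F y" using dense y(2) by blast
    then obtain \<beta> where "0 \<le> \<beta>" "d = ennreal \<beta>" by (cases d) auto
    then show thesis using d that by (auto simp: ennreal_less_zero_iff)
  qed
  have top: "F z = \<infinity>" if z: "min x y < z" "z < max x y" for z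
  proof (rule ccontr)
    assume "F z \<noteq> \<infinity>"
    then obtain r where r: "0 \<le> r" "F z = ennreal r" by (cases "F z") auto
    define t where "t = (z - x) / (y - x)"
    have t: "0 < t" "t < 1"
      using z y(1) by (auto simp: t_def min_def max_def zero_less_divide_iff divide_less_eq split: if_splits)
    have "t * (y - x) = z - x" using y(1) by (simp add: t_def)
    then have z_eq: "(1 - t) * x + t * y = z" by (simp add: algebra_simps)
    \<comment> \<open>Solves \<open>\<alpha> powr (1 - t) * \<beta> powr t = r + 1\<close>; it is
      admissible because \<open>F x\<close> exceeds every real.\<close>
    define \<alpha> where "\<alpha> = ((r + 1) / \<beta> powr t) powr (1 / (1 - t))"
    have \<alpha>: "0 < \<alpha>" "\<alpha> powr (1 - t) * \<beta> powr t = r + 1"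
      using r \<beta> t by (auto simp: \<alpha>_def powr_powr)
    have "ennreal (\<alpha> powr (1 - t) * \<beta> powr t) \<le> F ((1 - t) * x + t * y)"
      using x \<alpha> \<beta> by (intro geo_mean_leD[OF lc[OF t]]) auto
    then have "r + 1 \<le> r" unfolding z_eq r(2) \<alpha>(2) using r(1) by (subst (asm) ennreal_le_iff) auto
    then show False by simp
  qed
  have "(\<integral>\<^sup>+z. \<infinity> * indicator {min x y<..<max x y} z \<partial>lborel) \<le> (\<integral>\<^sup>+z. F z \<partial>lborel)"
    using top by (intro nn_integral_mono) (auto simp: indicator_def)
  moreover have "(\<integral>\<^sup>+z. \<infinity> * indicator {min x y<..<max x y} z \<partial>lborel) = \<infinity>"
    using y(1) by (subst nn_integral_cmult_indicator) (auto simp: ennreal_top_mult)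
  ultimately show False using F by (simp add: top_unique)
qed

text \<open>The strict approximations \<open>r * a\<close> and \<open>r * b\<close> with
  \<open>r < 1\<close> merely scale the mean by \<open>r\<close>, which then tends to 1.\<close>

lemma geo_mean_le_ennreal:
  assumes "geo_mean_le t (ennreal a) (ennreal b) (ennreal c)" "0 \<le> a" "0 \<le> b" "0 \<le> c"
  shows "a powr (1 - t) * b powr t \<le> c"
proof (cases "a = 0 \<or> b = 0")
  case False
  then have pos: "0 < a" "0 < b" using assms by auto
  show ?thesis
  proof (rule field_le_mult_one_interval)
    fix r :: real assume r: "0 < r" "r < 1"
    have "ennreal ((r * a) powr (1 - t) * (r * b) powr t) \<le> ennreal c"
      using r pos by (intro geo_mean_leD[OF assms(1)]) (auto intro!: ennreal_lessI)
    then have "(r * a) powr (1 - t) * (r * b) powr t \<le> c"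
      using assms(4) by (subst (asm) ennreal_le_iff) auto
    moreover have "(r * a) powr (1 - t) * (r * b) powr t = (r powr (1 - t) * r powr t) * (a powr (1 - t) * b powr t)"
      using r pos by (simp add: powr_mult)
    moreover have "r powr (1 - t) * r powr t = r" using r by (simp flip: powr_add)
    ultimately show "r * (a powr (1 - t) * b powr t) \<le> c" by simp
  qed
qed (use assms in auto)

text \<open>Symmetry of the law makes the density even only almost everywhere. Its minimum with its
  reflection is even at every point, equals it almost everywhere and stays log-concave, which an
  average need not.\<close>

lemma even_log_concave_density_exists:
  assumes M: "prob_space M" and S: "distributed M lborel S F"
    and lc: "\<And>t x y. 0 < t \<Longrightarrow> t < 1 \<Longrightarrow> geo_mean_le t (F x) (F y) (F ((1 - t) * x + t * y))"
    and sym: "distr M lborel (\<lambda>\<omega>. - S \<omega>) = distr M lborel S"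
  obtains f where "even_log_concave_density f" "distributed M lborel S (\<lambda>x. ennreal (f x))"
proof -
  interpret prob_space M by fact
  have F_meas[measurable]: "F \<in> borel_measurable borel" and S_meas[measurable]: "S \<in> borel_measurable M"
    using distributed_borel_measurable[OF S] distributed_measurable[OF S] by auto
  have F1: "(\<integral>\<^sup>+x. F x \<partial>lborel) = 1"
    using distributed_nn_integral[OF S, of "\<lambda>_. 1"] emeasure_space_1 by simp
  have fin: "F x < \<infinity>" for x by (rule log_concave_density_finite[OF F_meas F1 lc])
  define f0 where "f0 x = enn2real (F x)" for x
  have F_eq: "F x = ennreal (f0 x)" for x
    using fin[of x] by (simp add: f0_def less_top)
  have f0: "0 \<le> f0 x" for x by (simp add: f0_def)
  have [measurable]: "f0 \<in> borel_measurable borel" unfolding f0_def by measurable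
  have f0_lc: "f0 x powr (1 - t) * f0 y powr t \<le> f0 ((1 - t) * x + t * y)" if "0 < t" "t < 1" for t x y
    using lc[OF that, of x y] unfolding F_eq by (rule geo_mean_le_ennreal) (auto simp: f0)
  have AE_even: "AE x in lborel. F x = F (- x)"
  proof (rule distributed_unique[OF S])
    have "distributed M lborel (\<lambda>\<omega>. - S \<omega>) (\<lambda>x. F (- x))"
      using distributed_affine[OF S, of "-1" 0] by (simp add: divide_ennreal_def)
    then show "distributed M lborel S (\<lambda>x. F (- x))"
      by (simp add: distributed_def sym)
  qed
  define f where "f x = min (f0 x) (f0 (- x))" for x
  have AE_f: "AE x in lborel. F x = ennreal (f x)"
    using AE_even by eventually_elim (simp add: F_eq f_def f0)
  have S_f: "distributed M lborel S (\<lambda>x. ennreal (f x))"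
    by (rule distributed_cong_density[THEN iffD1, OF AE_f _ _ S]) (simp_all add: f_def)
  have "even_log_concave_density f"
  proof
    show "f \<in> borel_measurable borel" unfolding f_def by measurable
    show "0 \<le> f x" "f (- x) = f x" for x by (auto simp: f_def f0)
    show "(\<integral>\<^sup>+x. ennreal (f x) \<partial>lborel) = 1"
      using nn_integral_cong_AE[OF AE_f] F1 by simp
    fix t x y :: real assume t: "0 < t" "t < 1"
    have mono: "f x powr (1 - t) * f y powr t \<le> f0 x' powr (1 - t) * f0 y' powr t"
      if "f x \<le> f0 x'" "f y \<le> f0 y'" for x' y'
      using that t by (intro mult_mono powr_mono2) (auto simp: f_def f0)
    have "f x powr (1 - t) * f y powr t \<le> f0 ((1 - t) * x + t * y)"
      by (rule order_trans[OF mono f0_lc[OF t]]) (auto simp: f_def)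
    moreover have "f x powr (1 - t) * f y powr t \<le> f0 ((1 - t) * (- x) + t * (- y))"
      by (rule order_trans[OF mono f0_lc[OF t]]) (auto simp: f_def)
    moreover have "(1 - t) * (- x) + t * (- y) = - ((1 - t) * x + t * y)"
      by (simp add: algebra_simps)
    ultimately show "f x powr (1 - t) * f y powr t \<le> f ((1 - t) * x + t * y)"
      unfolding f_def by simp
  qed
  then show thesis using S_f by (rule that)
qed

text \<open>A positive number below \<open>exp_minus (\<psi> x)\<close> excludes the value
  \<open>\<infinity>\<close> at \<open>x\<close>, so convexity becomes an inequality between
  reals.\<close>

lemma ext_convex_geo_mean_le:
  assumes \<psi>: "ext_convex n \<psi>" and t: "0 < t" "t < 1"
    and xy: "x \<in> extensional {..<n}" "y \<in> extensional {..<n}"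
  shows "geo_mean_le t (ennreal (exp_minus (\<psi> x))) (ennreal (exp_minus (\<psi> y)))
    (ennreal (exp_minus (\<psi> (\<lambda>i\<in>{..<n}. (1 - t) * x i + t * y i))))"
  unfolding geo_mean_le_def
proof (intro allI impI)
  fix \<alpha> \<beta> :: real
  assume \<alpha>\<beta>: "0 < \<alpha>" "0 < \<beta>" "ennreal \<alpha> < ennreal (exp_minus (\<psi> x))" "ennreal \<beta> < ennreal (exp_minus (\<psi> y))"
  let ?z = "\<lambda>i\<in>{..<n}. (1 - t) * x i + t * y i"
  have space: "x \<in> space (lborel_n n)" "y \<in> space (lborel_n n)" "?z \<in> space (lborel_n n)"
    using xy by (auto simp: space_PiM PiE_def)
  have not_MInf: "\<psi> x \<noteq> - \<infinity>" "\<psi> y \<noteq> - \<infinity>" "\<psi> ?z \<noteq> - \<infinity>"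
    using \<psi> space unfolding ext_convex_def by blast+
  have less: "\<alpha> < exp_minus (\<psi> x)" "\<beta> < exp_minus (\<psi> y)"
    using \<alpha>\<beta> by (auto simp: ennreal_less_iff)
  then have "\<psi> x \<noteq> \<infinity>" "\<psi> y \<noteq> \<infinity>"
    using \<alpha>\<beta> by (auto simp: exp_minus_def)
  then obtain a b where ab: "\<psi> x = ereal a" "\<psi> y = ereal b"
    using not_MInf by (cases "\<psi> x"; cases "\<psi> y") auto
  have "\<psi> ?z \<le> ereal (1 - t) * \<psi> x + ereal t * \<psi> y"
    using \<psi> space t unfolding ext_convex_def by auto
  then obtain d where d: "\<psi> ?z = ereal d" "d \<le> (1 - t) * a + t * b"
    using not_MInf ab by (cases "\<psi> ?z") auto
  have "\<alpha> powr (1 - t) * \<beta> powr t \<le> exp (- a) powr (1 - t) * exp (- b) powr t"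
    using less \<alpha>\<beta> t by (intro mult_mono powr_mono2) (auto simp: ab exp_minus_def)
  also have "\<dots> = exp (- ((1 - t) * a + t * b))"
    by (simp add: powr_def algebra_simps flip: exp_add)
  also have "\<dots> \<le> exp (- d)" using d(2) by simp
  finally show "ennreal (\<alpha> powr (1 - t) * \<beta> powr t) \<le> ennreal (exp_minus (\<psi> ?z))"
    by (intro ennreal_leI) (simp add: d(1) exp_minus_def)
qed

lemma even_log_concave_density_scalar_prod:
  assumes M: "prob_space M" and sym: "symmetric_rv M n X" and lc: "log_concave_rv M n X"
    and w: "k < n" "w k \<noteq> 0"
  obtains f where "even_log_concave_density f"
    "distributed M lborel (\<lambda>\<omega>. scalar_prod n w (X \<omega>)) (\<lambda>x. ennreal (f x))"
proof -
  obtain \<psi> where \<psi>: "ext_convex n \<psi>" and X: "distributed M (lborel_n n) X (\<lambda>x. ennreal (exp_minus (\<psi> x)))"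
    using lc by (auto simp: log_concave_rv_def)
  obtain F where F: "distributed M lborel (\<lambda>\<omega>. scalar_prod n w (X \<omega>)) F"
    and F_lc: "\<And>t x y. 0 < t \<Longrightarrow> t < 1 \<Longrightarrow> geo_mean_le t (F x) (F y) (F ((1 - t) * x + t * y))"
  proof (rule scalar_prod_distributed[where p = "\<lambda>x. ennreal (exp_minus (\<psi> x))" and k = k and w = w, OF M X _ w])
    show "geo_mean_le t (ennreal (exp_minus (\<psi> x))) (ennreal (exp_minus (\<psi> y)))
      (ennreal (exp_minus (\<psi> (\<lambda>i\<in>{..<n}. (1 - t) * x i + t * y i))))"
      if "0 < t" "t < 1" "x \<in> extensional {..<n}" "y \<in> extensional {..<n}" for t x y
      using that by (rule ext_convex_geo_mean_le[OF \<psi>])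
  qed (rule that)
  have Xm[measurable]: "X \<in> measurable M (lborel_n n)"
    using sym by (simp add: symmetric_rv_def)
  have neg_meas[measurable]: "(\<lambda>\<omega>. \<lambda>i\<in>{..<n}. - X \<omega> i) \<in> measurable M (lborel_n n)"
  proof (rule measurable_restrict)
    fix i assume "i \<in> {..<n}"
    then have "(\<lambda>\<omega>. X \<omega> i) \<in> borel_measurable M"
      using measurable_compose[OF Xm measurable_component_singleton, of i] by simp
    then show "(\<lambda>\<omega>. - X \<omega> i) \<in> measurable M lborel" by simp
  qed
  have neg: "scalar_prod n w (\<lambda>i\<in>{..<n}. - X \<omega> i) = - scalar_prod n w (X \<omega>)" for \<omega>
    by (simp add: scalar_prod_def sum_negf)
  have "distr M lborel (\<lambda>\<omega>. - scalar_prod n w (X \<omega>))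
    = distr (distr M (lborel_n n) (\<lambda>\<omega>. \<lambda>i\<in>{..<n}. - X \<omega> i)) lborel (scalar_prod n w)"
    by (subst distr_distr) (auto simp: comp_def neg)
  also have "distr M (lborel_n n) (\<lambda>\<omega>. \<lambda>i\<in>{..<n}. - X \<omega> i) = distr M (lborel_n n) X"
    using sym by (simp add: symmetric_rv_def)
  also have "distr (distr M (lborel_n n) X) lborel (scalar_prod n w) = distr M lborel (\<lambda>\<omega>. scalar_prod n w (X \<omega>))"
    by (subst distr_distr) (auto simp: comp_def)
  finally show thesis
    using even_log_concave_density_exists[OF M F F_lc] that by blast
qed

text \<open>Vectors vanishing on the first \<open>n\<close> coordinates are separated because their
  projection is constant and has no density. If \<open>u\<close> or \<open>v\<close> is such a
  vector, \<open>u + v\<close> has the same projection as the other one.\<close>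

lemma rev_EPI_vector_fifth:
  assumes M: "prob_space M"
  shows "rev_EPI_vector (1/5) M"
  unfolding rev_EPI_vector_def
proof (intro allI impI, elim conjE)
  fix n X and u v :: "nat \<Rightarrow> real"
  assume X: "symmetric_rv M n X" "log_concave_rv M n X"
  have sum: "scalar_prod n (\<lambda>i. u i + v i) x = scalar_prod n u x + scalar_prod n v x" for x
    by (simp add: scalar_prod_def sum.distrib algebra_simps)
  have zero: "scalar_prod n w x = 0" if "\<forall>i<n. w i = 0" for w x
    using that by (simp add: scalar_prod_def)
  have nonneg: "0 \<le> exp_Ent (1/5) M n w X" for w by (simp add: exp_Ent_def)
  consider "\<forall>i<n. u i + v i = 0" | "\<forall>i<n. u i = 0" | "\<forall>i<n. v i = 0"
    | "\<exists>i<n. u i + v i \<noteq> 0" "\<exists>i<n. u i \<noteq> 0" "\<exists>i<n. v i \<noteq> 0"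
    by blast
  then show "exp_Ent (1/5) M n (\<lambda>i. u i + v i) X \<le> exp_Ent (1/5) M n u X + exp_Ent (1/5) M n v X"
  proof cases
    case 1
    then have "exp_Ent (1/5) M n (\<lambda>i. u i + v i) X = 0" by (simp add: exp_Ent_def)
    then show ?thesis using nonneg[of u] nonneg[of v] by linarith
  next
    case 2
    then have "exp_Ent (1/5) M n (\<lambda>i. u i + v i) X = exp_Ent (1/5) M n v X"
      unfolding exp_Ent_def sum by (simp add: zero)
    then show ?thesis using nonneg[of u] by linarith
  next
    case 3
    then have "exp_Ent (1/5) M n (\<lambda>i. u i + v i) X = exp_Ent (1/5) M n u X"
      unfolding exp_Ent_def sum by (simp add: zero)
    then show ?thesis using nonneg[of v] by linarith
  next
    case 4
    obtain f where f: "even_log_concave_density f"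
      "distributed M lborel (\<lambda>\<omega>. scalar_prod n u (X \<omega>)) (\<lambda>x. ennreal (f x))"
      using even_log_concave_density_scalar_prod[OF M X] 4(2) by blast
    obtain g where g: "even_log_concave_density g"
      "distributed M lborel (\<lambda>\<omega>. scalar_prod n v (X \<omega>)) (\<lambda>x. ennreal (g x))"
      using even_log_concave_density_scalar_prod[OF M X] 4(3) by blast
    obtain h where h: "even_log_concave_density h"
      "distributed M lborel (\<lambda>\<omega>. scalar_prod n (\<lambda>i. u i + v i) (X \<omega>)) (\<lambda>x. ennreal (h x))"
      using even_log_concave_density_scalar_prod[OF M X, of _ "\<lambda>i. u i + v i"] 4(1) by blast
    have "exp (1/5 * Ent M (\<lambda>\<omega>. scalar_prod n u (X \<omega>) + scalar_prod n v (X \<omega>)))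
      \<le> exp (1/5 * Ent M (\<lambda>\<omega>. scalar_prod n u (X \<omega>))) + exp (1/5 * Ent M (\<lambda>\<omega>. scalar_prod n v (X \<omega>)))"
      using M f(1) g(1) h(1) f(2) g(2) h(2)[unfolded sum] by (rule exp_fifth_entropy_sum_le)
    moreover have "exp_Ent (1/5) M n w X = exp (1/5 * Ent M (\<lambda>\<omega>. scalar_prod n w (X \<omega>)))"
      if "\<exists>i<n. w i \<noteq> 0" for w
      unfolding exp_Ent_def using that by auto
    ultimately show ?thesis
      using 4 unfolding sum[symmetric] by simp
  qed
qed

lemma rev_EPI_pair_of_vector:
  assumes "rev_EPI_vector \<kappa> M"
  shows "rev_EPI_pair \<kappa> M"
  unfolding rev_EPI_pair_def
proof (intro allI impI, elim conjE)
  fix X Y :: "'a \<Rightarrow> real"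
  assume XY: "symmetric_rv M 2 (pair_rv X Y)" "log_concave_rv M 2 (pair_rv X Y)"
  define u v :: "nat \<Rightarrow> real" where "u i = (if i = 0 then 1 else 0)" and "v i = (if i = 1 then 1 else 0)" for i
  have prods: "scalar_prod 2 u (pair_rv X Y \<omega>) = X \<omega>" "scalar_prod 2 v (pair_rv X Y \<omega>) = Y \<omega>"
    "scalar_prod 2 (\<lambda>i. u i + v i) (pair_rv X Y \<omega>) = X \<omega> + Y \<omega>" for \<omega>
    by (simp_all add: scalar_prod_def pair_rv_def u_def v_def numeral_2_eq_2)
  have "exp_Ent \<kappa> M 2 (\<lambda>i. u i + v i) (pair_rv X Y)
    \<le> exp_Ent \<kappa> M 2 u (pair_rv X Y) + exp_Ent \<kappa> M 2 v (pair_rv X Y)"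
    using assms XY unfolding rev_EPI_vector_def by (meson one_le_numeral)
  moreover have "\<not> (\<forall>i<2. u i = 0)" "\<not> (\<forall>i<2. v i = 0)" "\<not> (\<forall>i<2. u i + v i = 0)"
    by (auto simp: u_def v_def intro: exI[of _ 0] exI[of _ 1])
  ultimately show "exp (\<kappa> * Ent M (\<lambda>\<omega>. X \<omega> + Y \<omega>)) \<le> exp (\<kappa> * Ent M X) + exp (\<kappa> * Ent M Y)"
    unfolding exp_Ent_def prods by simp
qed

theorem theorem1:
  shows "(\<exists>\<kappa>::real. \<kappa> > 0 \<and>
            (\<forall>M :: 'a measure. prob_space M \<longrightarrow> rev_EPI_vector \<kappa> M \<and> rev_EPI_pair \<kappa> M)) \<and>
         (\<forall>M :: 'a measure. prob_space M \<longrightarrow> rev_EPI_vector (1/5) M \<and> rev_EPI_pair (1/5) M)"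
proof -
  have *: "\<forall>M :: 'a measure. prob_space M \<longrightarrow> rev_EPI_vector (1/5) M \<and> rev_EPI_pair (1/5) M"
    using rev_EPI_vector_fifth rev_EPI_pair_of_vector by blast
  then show ?thesis by (intro conjI exI[of _ "1/5"]) auto
qed

end
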